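(* Let $n\ge 2$ and $J_n=\mathbb{C}^{S_{n-1}}\#\mathbb{C}C_n$ with $C_n=\langle a\rangle$. Let $x\in S_{n-1}$ with $F_x=\langle a^t\rangle$ and $x^{-1}=x\lhd a^s\in\mathcal{O}_x$ for some integer $s$. Let $\zeta$ be a primitive $\frac nt$-th root of unity in $\mathbb{C}$, let $i$ be an integer, let $\rho_{x,i}:F_x\to\mathbb{C}^\times$ be the irreducible representation with $\rho_{x,i}(a^t)=\zeta^i$, with character $\chi_{x,i}$, and let $\hat\chi_{x,i}$ be the character of the induced $J_n$-module. Then $x(t)+t$ and $x(s)+s$ are multiples of $t$ modulo $n$; write $x(t)+t=u_1t$ and $x(s)+s=u_2t$ modulo $n$. Moreover: (1) if $\frac nt$ is odd, then $$\nu(\hat\chi_{x,i})=\begin{cases}1&\text{if }\zeta^{iu_1}=1,\\0&\text{if }\zeta^{iu_1}\neq1;\end{cases}$$ (2) if $\frac nt$ is even, then $$\nu(\hat\chi_{x,i})=\begin{cases}\zeta^{-iu_2}\in\{1,-1\}&\text{if }\zeta^{iu_1}=1,\\0&\text{if }\zeta^{iu_1}\neq1.\end{cases}$$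
   Context: Identify $\{1,\dots,n\}$ with $\mathbb{Z}/n\mathbb{Z}$ (so $n=0$) and $S_n$ with the bijections of $\mathbb{Z}/n\mathbb{Z}$ under composition (right-to-left). $S_{n-1}$ is the subgroup of those $x$ with $x(n)=n$; $a=(1\,2\,\cdots\,n)$ is the shift $i\mapsto i+1$; $C_n=\langle a\rangle$. Values of permutations are added modulo $n$. Each product $xa^r$ ($x\in S_{n-1}$) factors uniquely as $xa^r=(x\rhd a^r)(x\lhd a^r)$ with $x\rhd a^r\in C_n$, $x\lhd a^r\in S_{n-1}$; explicitly $x\rhd a^r=a^{x(r)}$ and $x\lhd a^r=a^{-x(r)}xa^r$. $\lhd$ is a right action of $C_n$ on the set $S_{n-1}$; $\mathcal{O}_x$ is the orbit and $F_x=\{b\in C_n: x\lhd b=x\}$ the stabilizer of $x$. Whenever we write $F_x=\langle a^t\rangle$, $t$ is the smallest positive such exponent, i.e. the positive divisor of $n$ with this property. $J_n=\mathbb{C}^{S_{n-1}}\#\mathbb{C}C_n$ is the semisimple Hopf algebra with basis $p_y\#b$ ($y\in S_{n-1}$, $b\in C_n$), product $(p_y\#b)(p_z\#c)=\delta_{z,\,y\lhd b}\,p_y\#bc$, unit $\sum_y p_y\#1$, counit $\varepsilon(p_y\#b)=\delta_{y,1}$, coproduct $\Delta(p_y\#b)=\sum_{z}(p_{yz^{-1}}\#(z\rhd b))\otimes(p_z\#b)$, antipode $S(p_y\#b)=p_{(y\lhd b)^{-1}}\#(y\rhd b)^{-1}$. For an irreducible representation $V$ of $F_x$, the induced irreducible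 $J_n$-module is $\hat V=\mathbb{C}C_n\otimes_{\mathbb{C}F_x}V$ with $(p_y\#b)\cdot(c\otimes v)=\delta_{y\lhd(bc),x}\,(bc\otimes v)$. The Frobenius-Schur indicator of a $J_n$-module with character $\chi$ is $\nu(\chi)=\chi(\sum\Lambda_1\Lambda_2)$, where $\Lambda$ is the two-sided integral of $J_n$ with $\varepsilon(\Lambda)=1$ and $\Delta(\Lambda)=\sum\Lambda_1\otimes\Lambda_2$. *)

theory Defs
  imports
    "HOL.Complex"
    "HOL-Library.Function_Algebras"
    "HOL-Combinatorics.Permutations"
    "HOL-Number_Theory.Cong"
    "HOL-Algebra.Generated_Groups"
begin

section \<open>The factorization of the symmetric group\<close>

type_synonym perm = "int \<Rightarrow> int"

text \<open>
  The residue ring of integers modulo \<open>n\<close> is represented by \<open>{0..<n}\<close>, so that the point \<open>n\<close>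
  becomes \<open>0\<close>. The value of a permutation at an arbitrary integer \<open>r\<close> is \<open>x (r mod n)\<close>.
\<close>

definition SymZ :: "nat \<Rightarrow> perm monoid" where
  "SymZ n = \<lparr>carrier = {p. p permutes {0..<int n}}, mult = (\<circ>), one = id\<rparr>"

definition Sym1 :: "nat \<Rightarrow> perm set" where
  "Sym1 n = {x \<in> carrier (SymZ n). x 0 = 0}"

definition shift :: "nat \<Rightarrow> perm" where
  "shift n = (\<lambda>i. if i \<in> {0..<int n} then (i + 1) mod int n else i)"

definition Cyc :: "nat \<Rightarrow> perm set" where
  "Cyc n = generate (SymZ n) {shift n}"

definition factorization :: "nat \<Rightarrow> perm \<Rightarrow> perm \<Rightarrow> perm \<times> perm" where
  "factorization n x b = (THE (c, z). c \<in> Cyc n \<and> z \<in> Sym1 n \<and> x \<circ> b = c \<circ> z)"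

definition left_act :: "nat \<Rightarrow> perm \<Rightarrow> perm \<Rightarrow> perm" where
  "left_act n x b = fst (factorization n x b)"

definition right_act :: "nat \<Rightarrow> perm \<Rightarrow> perm \<Rightarrow> perm" where
  "right_act n x b = snd (factorization n x b)"

definition stab :: "nat \<Rightarrow> perm \<Rightarrow> perm set" where
  "stab n x = {b \<in> Cyc n. right_act n x b = x}"

lemma group_SymZ: "group (SymZ n)"
  using permutes_inv permutes_inv_o(2)
  by (auto intro!: groupI simp add: SymZ_def permutes_compose permutes_id comp_assoc, blast)

definition rot :: "nat \<Rightarrow> int \<Rightarrow> perm" where
  "rot n r = (\<lambda>i. if i \<in> {0..<int n} then (i + r) mod int n else i)"

lemma rot_comp: "n > 0 \<Longrightarrow> rot n r \<circ> rot n s = rot n (r + s)"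
  by (auto simp: rot_def fun_eq_iff mod_add_left_eq mod_add_right_eq ac_simps)

lemma rot_0: "rot n 0 = id"
  by (auto simp: rot_def fun_eq_iff)

lemma rot_mod: "rot n (r mod int n) = rot n r" "rot n (- (r mod int n)) = rot n (- r)"
  by (simp_all add: rot_def fun_eq_iff mod_add_right_eq mod_diff_right_eq)

lemma rot_carrier:
  assumes "n > 0"
  shows "rot n r \<in> carrier (SymZ n)"
proof -
  have l: "rot n r \<circ> rot n (- r) = id" and r: "rot n (- r) \<circ> rot n r = id"
    using assms by (simp_all add: rot_comp rot_0)
  have "bij (rot n r)"
    using o_bij[OF r l] .
  moreover have "rot n r i = i" if "i \<notin> {0..<int n}" for i
    using that by (simp only: rot_def if_False)
  ultimately show ?thesis
    by (simp add: SymZ_def permutes_def bij_iff)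
qed

lemma inv_rot:
  assumes "n > 0"
  shows "inv\<^bsub>SymZ n\<^esub> (rot n r) = rot n (- r)"
proof (rule group.inv_equality[OF group_SymZ])
  show "rot n (- r) \<otimes>\<^bsub>SymZ n\<^esub> rot n r = \<one>\<^bsub>SymZ n\<^esub>"
    using assms rot_comp[of n "- r" r] by (simp add: SymZ_def rot_0)
qed (use assms rot_carrier in auto)

lemma shift_nat_pow:
  assumes "n > 0"
  shows "shift n [^]\<^bsub>SymZ n\<^esub> (k::nat) = rot n (int k)"
proof (induction k)
  case 0
  show ?case by (simp add: SymZ_def rot_0)
next
  case (Suc k)
  have "shift n [^]\<^bsub>SymZ n\<^esub> Suc k = rot n (int k) \<circ> rot n 1"
    unfolding nat_pow_Suc Suc by (simp add: SymZ_def shift_def rot_def)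
  also have "\<dots> = rot n (int (Suc k))"
    unfolding rot_comp[OF assms] by (simp add: ac_simps)
  finally show ?case .
qed

lemma shift_int_pow:
  assumes "n > 0"
  shows "shift n [^]\<^bsub>SymZ n\<^esub> (r::int) = rot n r"
  unfolding int_pow_def2 shift_nat_pow[OF assms] inv_rot[OF assms] by simp

lemma Cyc_eq:
  assumes "n > 0"
  shows "Cyc n = range (rot n)"
proof -
  have "shift n = rot n 1"
    by (simp add: shift_def rot_def)
  hence "shift n \<in> carrier (SymZ n)"
    using rot_carrier[OF assms] by simp
  from group.generate_pow[OF group_SymZ this] show ?thesis
    unfolding Cyc_def shift_int_pow[OF assms] by (simp add: image_def)
qed

lemma factorization_eq:
  assumes n: "n > 0" and x: "x \<in> Sym1 n"
  shows "factorization n x (rot n r) =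
           (rot n (x (r mod int n)), rot n (- x (r mod int n)) \<circ> x \<circ> rot n r)"
  unfolding factorization_def
proof (rule the_equality, goal_cases)
  case 1
  let ?k = "x (r mod int n)" and ?z = "rot n (- x (r mod int n)) \<circ> x \<circ> rot n r"
  have x': "x \<in> carrier (SymZ n)"
    using x by (simp add: Sym1_def)
  have z: "?z \<in> carrier (SymZ n)"
    using x' rot_carrier[OF n, of "- ?k"] rot_carrier[OF n, of r]
    by (simp add: SymZ_def permutes_compose)
  have "?k \<in> {0..<int n}"
    using x' n permutes_in_image[of x "{0..<int n}" "r mod int n"] by (simp add: SymZ_def)
  hence "?z 0 = 0"
    using n by (simp add: rot_def)
  moreover have "x \<circ> rot n r = rot n ?k \<circ> ?z"
    unfolding comp_assoc[symmetric] rot_comp[OF n] by (simp add: rot_0)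
  ultimately show ?case
    using z n by (simp add: Sym1_def Cyc_eq)
next
  case (2 cz)
  then obtain k z where cz: "cz = (rot n k, z)" and z: "z \<in> Sym1 n"
    and eq: "x \<circ> rot n r = rot n k \<circ> z"
    using n by (auto simp: Cyc_eq)
  have "x (r mod int n) = k mod int n"
    using fun_cong[OF eq, of 0] n z by (simp add: rot_def Sym1_def)
  hence "rot n (x (r mod int n)) = rot n k" "rot n (- x (r mod int n)) = rot n (- k)"
    by (simp_all only: rot_mod)
  moreover have "rot n (- k) \<circ> (x \<circ> rot n r) = z"
    unfolding eq comp_assoc[symmetric] rot_comp[OF n] by (simp add: rot_0)
  ultimately show ?case
    by (simp add: cz comp_assoc)
qed

lemma left_act_shift_pow:
  fixes r :: int
  assumes "n > 0" "x \<in> Sym1 n"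
  shows "left_act n x (shift n [^]\<^bsub>SymZ n\<^esub> r) =
           shift n [^]\<^bsub>SymZ n\<^esub> x (r mod int n)"
  using assms by (simp add: left_act_def factorization_eq shift_int_pow)

lemma right_act_shift_pow:
  fixes r :: int
  assumes "n > 0" "x \<in> Sym1 n"
  shows "right_act n x (shift n [^]\<^bsub>SymZ n\<^esub> r) =
           shift n [^]\<^bsub>SymZ n\<^esub> (- x (r mod int n)) \<otimes>\<^bsub>SymZ n\<^esub> x
             \<otimes>\<^bsub>SymZ n\<^esub> shift n [^]\<^bsub>SymZ n\<^esub> r"
  using assms by (simp add: right_act_def factorization_eq shift_int_pow) (simp add: SymZ_def)


section \<open>The Hopf algebra\<close>

text \<open>
  The complex vector space with basis \<open>B\<close> is the space of functions into \<open>complex\<close> that vanish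
  outside \<open>B\<close>; \<open>ket k\<close> is the basis vector indexed by \<open>k\<close>.
\<close>

definition cscale :: "complex \<Rightarrow> ('k \<Rightarrow> complex) \<Rightarrow> 'k \<Rightarrow> complex"  (infixr \<open>*\<^sub>C\<close> 75) where
  "c *\<^sub>C f = (\<lambda>k. c * f k)"

global_interpretation cfun: vector_space cscale
  by unfold_locales (simp_all add: cscale_def fun_eq_iff algebra_simps)

definition ket :: "'k \<Rightarrow> 'k \<Rightarrow> complex" where
  "ket k = (\<lambda>j. if j = k then 1 else 0)"

definition free_space :: "'k set \<Rightarrow> ('k \<Rightarrow> complex) set" where
  "free_space B = {f. \<forall>k. k \<notin> B \<longrightarrow> f k = 0}"

text \<open>
  The index \<open>(y, b)\<close> stands for the basis element \<open>p\<^sub>y # b\<close>. The operations are given on basis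
  elements and extended linearly; an element of the tensor square is a function on pairs of
  indices. The unit and the antipode play no role in the indicator and are not needed here.
\<close>

type_synonym idx = "perm \<times> perm"

definition J_basis :: "nat \<Rightarrow> idx set" where
  "J_basis n = Sym1 n \<times> Cyc n"

abbreviation J :: "nat \<Rightarrow> (idx \<Rightarrow> complex) set" where
  "J n \<equiv> free_space (J_basis n)"

definition mult_basis :: "nat \<Rightarrow> idx \<Rightarrow> idx \<Rightarrow> idx \<Rightarrow> complex" where
  "mult_basis n = (\<lambda>(y, b) (z, c). if z = right_act n y b then ket (y, b \<circ> c) else 0)"

definition J_mult :: "nat \<Rightarrow> (idx \<Rightarrow> complex) \<Rightarrow> (idx \<Rightarrow> complex) \<Rightarrow> idx \<Rightarrow> complex" where
  "J_mult n f g = (\<Sum>p\<in>J_basis n. \<Sum>q\<in>J_basis n. (f p * g q) *\<^sub>C mult_basis n p q)"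

definition mult_tensor :: "nat \<Rightarrow> (idx \<times> idx \<Rightarrow> complex) \<Rightarrow> idx \<Rightarrow> complex" where
  "mult_tensor n w = (\<Sum>(p, q)\<in>J_basis n \<times> J_basis n. w (p, q) *\<^sub>C mult_basis n p q)"

definition J_counit :: "nat \<Rightarrow> (idx \<Rightarrow> complex) \<Rightarrow> complex" where
  "J_counit n f = (\<Sum>(y, b)\<in>J_basis n. f (y, b) * (if y = id then 1 else 0))"

definition J_comult :: "nat \<Rightarrow> (idx \<Rightarrow> complex) \<Rightarrow> idx \<times> idx \<Rightarrow> complex" where
  "J_comult n f = (\<Sum>(y, b)\<in>J_basis n. f (y, b) *\<^sub>C
     (\<Sum>z\<in>Sym1 n. ket ((y \<circ> inv\<^bsub>SymZ n\<^esub> z, left_act n z b), (z, b))))"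

definition normalized_integral :: "nat \<Rightarrow> (idx \<Rightarrow> complex) \<Rightarrow> bool" where
  "normalized_integral n \<Lambda> \<longleftrightarrow> \<Lambda> \<in> J n \<and>
     (\<forall>h\<in>J n. J_mult n h \<Lambda> = J_counit n h *\<^sub>C \<Lambda> \<and> J_mult n \<Lambda> h = J_counit n h *\<^sub>C \<Lambda>) \<and>
     J_counit n \<Lambda> = 1"

lemma finite_J_basis:
  assumes "n > 0"
  shows "finite (Cyc n)" "finite (Sym1 n)"
proof -
  have fin: "finite (carrier (SymZ n))"
    by (simp add: SymZ_def finite_permutations)
  moreover have "Cyc n \<subseteq> carrier (SymZ n)"
    using rot_carrier[OF assms] by (auto simp: Cyc_eq[OF assms])
  ultimately show "finite (Cyc n)" "finite (Sym1 n)"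
    by (auto intro: finite_subset simp: Sym1_def)
qed

lemma sum_fun_apply: "(\<Sum>a\<in>A. F a) k = (\<Sum>a\<in>A. F a k :: complex)"
  by (induction A rule: infinite_finite_induct) auto

lemma rot_eq_comp_iff:
  assumes "n > 0"
  shows "rot n r = rot n s \<circ> c \<longleftrightarrow> c = rot n (r - s)"
proof
  assume "rot n r = rot n s \<circ> c"
  hence "rot n (- s) \<circ> rot n r = (rot n (- s) \<circ> rot n s) \<circ> c"
    by (simp only: comp_assoc)
  thus "c = rot n (r - s)"
    unfolding rot_comp[OF assms] by (simp add: rot_0)
next
  assume "c = rot n (r - s)"
  thus "rot n r = rot n s \<circ> c"
    by (simp only: rot_comp[OF assms]) simp
qed

lemma right_act_in_Sym1:
  assumes n: "n > 0" and x: "x \<in> Sym1 n"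
  shows "right_act n x (rot n r) \<in> Sym1 n"
proof -
  let ?k = "x (r mod int n)" and ?z = "rot n (- x (r mod int n)) \<circ> x \<circ> rot n r"
  have x': "x \<in> carrier (SymZ n)"
    using x by (simp add: Sym1_def)
  have z: "?z \<in> carrier (SymZ n)"
    using x' rot_carrier[OF n, of "- ?k"] rot_carrier[OF n, of r]
    by (simp add: SymZ_def permutes_compose)
  have "?k \<in> {0..<int n}"
    using x' n permutes_in_image[of x "{0..<int n}" "r mod int n"] by (simp add: SymZ_def)
  hence "?z 0 = 0"
    using n by (simp add: rot_def)
  thus ?thesis
    using z by (simp add: right_act_def factorization_eq[OF n x] Sym1_def)
qed

lemma right_act_eq_id_iff:
  assumes n: "n > 0" and x: "x \<in> Sym1 n"
  shows "right_act n x (rot n r) = id \<longleftrightarrow> x = id"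
proof
  assume "x = id"
  thus "right_act n x (rot n r) = id"
    using factorization_eq[OF n x, of r]
    by (simp add: right_act_def rot_mod rot_comp[OF n] rot_0)
next
  assume "right_act n x (rot n r) = id"
  hence "rot n (- x (r mod int n)) \<circ> (x \<circ> rot n r) = id"
    by (simp add: right_act_def factorization_eq[OF n x] comp_assoc)
  hence "rot n (x (r mod int n)) \<circ> (rot n (- x (r mod int n)) \<circ> (x \<circ> rot n r))
           = rot n (x (r mod int n))"
    by simp
  hence "x \<circ> rot n r = rot n (x (r mod int n))"
    unfolding comp_assoc[symmetric] rot_comp[OF n] by (simp add: rot_0)
  hence "(x \<circ> rot n r) \<circ> rot n (- r) = rot n (x (r mod int n)) \<circ> rot n (- r)"
    by simp
  hence eq: "x = rot n (x (r mod int n) - r)"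
    unfolding comp_assoc rot_comp[OF n] by (simp add: rot_0)
  have "(x (r mod int n) - r) mod int n = 0"
    using fun_cong[OF eq, of 0] x n by (simp add: rot_def Sym1_def)
  hence "rot n (x (r mod int n) - r) = id"
    using rot_mod(1)[of n "x (r mod int n) - r"] by (simp add: rot_0)
  thus "x = id"
    using eq by simp
qed

lemma J_mult_apply:
  assumes n: "n > 0" and w: "w \<in> Sym1 n"
  shows "J_mult n f g (w, rot n r) =
           (\<Sum>b\<in>Cyc n. f (w, b) * g (right_act n w b, inv\<^bsub>SymZ n\<^esub> b \<circ> rot n r))"
proof -
  have "J_mult n f g (w, rot n r) =
          (\<Sum>y\<in>Sym1 n. \<Sum>b\<in>Cyc n. \<Sum>z\<in>Sym1 n. \<Sum>c\<in>Cyc n.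
             f (y, b) * g (z, c) * mult_basis n (y, b) (z, c) (w, rot n r))"
    by (simp only: J_mult_def sum_fun_apply cscale_def J_basis_def sum.cartesian_product')
  also have "\<dots> = (\<Sum>y\<in>Sym1 n. if y = w then \<Sum>b\<in>Cyc n. \<Sum>z\<in>Sym1 n. \<Sum>c\<in>Cyc n.
             f (w, b) * g (z, c) * mult_basis n (w, b) (z, c) (w, rot n r) else 0)"
    by (intro sum.cong refl) (auto simp: mult_basis_def ket_def intro!: sum.neutral)
  also have "\<dots> = (\<Sum>b\<in>Cyc n. \<Sum>z\<in>Sym1 n. \<Sum>c\<in>Cyc n.
             f (w, b) * g (z, c) * mult_basis n (w, b) (z, c) (w, rot n r))"
    using w finite_J_basis[OF n] by simp
  also have "\<dots> = (\<Sum>b\<in>Cyc n. f (w, b) * g (right_act n w b, inv\<^bsub>SymZ n\<^esub> b \<circ> rot n r))"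
  proof (intro sum.cong refl)
    fix b assume "b \<in> Cyc n"
    then obtain s where s: "b = rot n s"
      using n by (auto simp: Cyc_eq)
    have inv: "inv\<^bsub>SymZ n\<^esub> b \<circ> rot n r = rot n (r - s)"
      unfolding s inv_rot[OF n] rot_comp[OF n] by simp
    have mem: "rot n (r - s) \<in> Cyc n" "right_act n w b \<in> Sym1 n"
      using n right_act_in_Sym1[OF n w] by (auto simp: Cyc_eq s)
    have "(\<Sum>z\<in>Sym1 n. \<Sum>c\<in>Cyc n. f (w, b) * g (z, c) * mult_basis n (w, b) (z, c) (w, rot n r))
            = (\<Sum>z\<in>Sym1 n. \<Sum>c\<in>Cyc n. if z = right_act n w b then
                 if c = rot n (r - s) then f (w, b) * g (z, c) else 0 else 0)"
      unfolding s mult_basis_def ket_def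
      by (intro sum.cong refl) (auto simp: rot_eq_comp_iff[OF n])
    also have "\<dots> = (\<Sum>z\<in>Sym1 n. if z = right_act n w b then f (w, b) * g (z, rot n (r - s)) else 0)"
      using mem finite_J_basis[OF n] by (intro sum.cong refl) auto
    also have "\<dots> = f (w, b) * g (right_act n w b, rot n (r - s))"
      using mem finite_J_basis[OF n] by simp
    finally show "(\<Sum>z\<in>Sym1 n. \<Sum>c\<in>Cyc n.
        f (w, b) * g (z, c) * mult_basis n (w, b) (z, c) (w, rot n r)) =
        f (w, b) * g (right_act n w b, inv\<^bsub>SymZ n\<^esub> b \<circ> rot n r)"
      unfolding inv .
  qed
  finally show ?thesis .
qed

lemma J_mult_closed:
  assumes n: "n > 0"
  shows "J_mult n f g \<in> J n"
proof -
  have "b \<circ> c \<in> Cyc n" if "b \<in> Cyc n" "c \<in> Cyc n" for b c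
    using that n by (auto simp: Cyc_eq rot_comp)
  hence "mult_basis n p q k = 0" if "p \<in> J_basis n" "q \<in> J_basis n" "k \<notin> J_basis n" for p q k
    using that by (auto simp: J_basis_def mult_basis_def ket_def split: prod.splits)
  thus ?thesis
    by (auto simp: J_mult_def free_space_def sum_fun_apply cscale_def intro!: sum.neutral)
qed

lemma counit_eq:
  assumes "n > 0"
  shows "J_counit n f = (\<Sum>b\<in>Cyc n. f (id, b))"
proof -
  have "J_counit n f = (\<Sum>y\<in>Sym1 n. if y = id then \<Sum>b\<in>Cyc n. f (id, b) else 0)"
    unfolding J_counit_def J_basis_def sum.cartesian_product[symmetric]
    by (intro sum.cong refl) auto
  also have "id \<in> Sym1 n"
    by (simp add: Sym1_def SymZ_def permutes_id)
  hence "(\<Sum>y\<in>Sym1 n. if y = id then \<Sum>b\<in>Cyc n. f (id, b) else 0) = (\<Sum>b\<in>Cyc n. f (id, b))"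
    using finite_J_basis[OF assms] by simp
  finally show ?thesis .
qed

lemma normalized_integral_explicit:
  assumes n: "n > 0"
  shows "normalized_integral n
           (\<lambda>(y, b). if y = id \<and> b \<in> Cyc n then 1 / of_nat (card (Cyc n)) else 0)"
    (is "normalized_integral n ?L")
proof -
  let ?N = "of_nat (card (Cyc n)) :: complex"
  have id1: "id \<in> Sym1 n"
    by (simp add: Sym1_def SymZ_def permutes_id)
  have "Cyc n \<noteq> {}"
    using n by (simp add: Cyc_eq)
  hence N: "?N \<noteq> 0"
    using finite_J_basis[OF n] by simp
  have L: "?L \<in> J n"
    using id1 by (auto simp: free_space_def J_basis_def)
  have right_id: "right_act n id b = id" if "b \<in> Cyc n" for b
    using that n id1 by (auto simp: Cyc_eq right_act_eq_id_iff)
  have "J_mult n h ?L k = (J_counit n h *\<^sub>C ?L) k \<and> J_mult n ?L h k = (J_counit n h *\<^sub>C ?L) k" for h k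
  proof (cases "k \<in> J_basis n")
    case False
    hence "J_mult n f g k = 0" for f g
      using J_mult_closed[OF n, of f g] unfolding free_space_def by blast
    moreover have "?L k = 0"
      using L False unfolding free_space_def by blast
    ultimately show ?thesis
      by (simp add: cscale_def)
  next
    case True
    then obtain w r where k: "k = (w, rot n r)" and w: "w \<in> Sym1 n"
      using n by (auto simp: J_basis_def Cyc_eq)
    have r: "rot n r \<in> Cyc n" using n by (simp add: Cyc_eq)
    have mem: "inv\<^bsub>SymZ n\<^esub> b \<circ> rot n r \<in> Cyc n" if "b \<in> Cyc n" for b
      using that n by (auto simp: Cyc_eq inv_rot rot_comp)
    have id_iff: "right_act n w b = id \<longleftrightarrow> w = id" if "b \<in> Cyc n" for b
      using that n w by (auto simp: Cyc_eq right_act_eq_id_iff)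
    have "J_mult n h ?L k = (\<Sum>b\<in>Cyc n. if w = id then h (id, b) / ?N else 0)"
      unfolding k J_mult_apply[OF n w] by (intro sum.cong refl) (simp add: mem id_iff)
    also have "\<dots> = (J_counit n h *\<^sub>C ?L) k"
      using r by (simp add: counit_eq[OF n] k cscale_def sum_divide_distrib)
    finally have 1: "J_mult n h ?L k = (J_counit n h *\<^sub>C ?L) k" .
    have "J_mult n ?L h k =
            (\<Sum>b\<in>Cyc n. if w = id then h (id, inv\<^bsub>SymZ n\<^esub> b \<circ> rot n r) / ?N else 0)"
      unfolding k J_mult_apply[OF n w] by (intro sum.cong refl) (auto simp: right_id)
    also have "\<dots> = (if w = id then (\<Sum>b\<in>Cyc n. h (id, inv\<^bsub>SymZ n\<^esub> b \<circ> rot n r)) / ?N else 0)"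
      by (simp add: sum_divide_distrib)
    also have "(\<Sum>b\<in>Cyc n. h (id, inv\<^bsub>SymZ n\<^esub> b \<circ> rot n r)) = (\<Sum>b\<in>Cyc n. h (id, b))"
    proof (rule sum.reindex_bij_witness[where i = "\<lambda>b. rot n r \<circ> inv\<^bsub>SymZ n\<^esub> b"
          and j = "\<lambda>b. inv\<^bsub>SymZ n\<^esub> b \<circ> rot n r"])
    qed (use n in \<open>auto simp: Cyc_eq inv_rot rot_comp\<close>)
    also have "(if w = id then (\<Sum>b\<in>Cyc n. h (id, b)) / ?N else 0) = (J_counit n h *\<^sub>C ?L) k"
      using r by (simp add: counit_eq[OF n] k cscale_def)
    finally show ?thesis
      using 1 by (intro conjI)
  qed
  moreover have "J_counit n ?L = 1"
    using N by (simp add: counit_eq[OF n])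
  ultimately show ?thesis
    using L by (simp add: normalized_integral_def fun_eq_iff)
qed

lemma normalized_integral_ex1:
  assumes "n > 0"
  shows "\<exists>!\<Lambda>. normalized_integral n \<Lambda>"
proof (rule ex_ex1I)
  fix \<Lambda> \<Lambda>' assume *: "normalized_integral n \<Lambda>" "normalized_integral n \<Lambda>'"
  have "J_mult n \<Lambda> \<Lambda>' = J_counit n \<Lambda> *\<^sub>C \<Lambda>'" "J_mult n \<Lambda> \<Lambda>' = J_counit n \<Lambda>' *\<^sub>C \<Lambda>"
    and "J_counit n \<Lambda> = 1" "J_counit n \<Lambda>' = 1"
    using * unfolding normalized_integral_def by blast+
  thus "\<Lambda> = \<Lambda>'"
    by simp
qed (use normalized_integral_explicit[OF assms] in blast)

definition J_integral :: "nat \<Rightarrow> idx \<Rightarrow> complex" where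
  "J_integral n = (THE \<Lambda>. normalized_integral n \<Lambda>)"

definition fs_indicator :: "nat \<Rightarrow> ((idx \<Rightarrow> complex) \<Rightarrow> complex) \<Rightarrow> complex" where
  "fs_indicator n \<chi> = \<chi> (mult_tensor n (J_comult n (J_integral n)))"


section \<open>Induced modules and their characters\<close>

text \<open>
  For a subspace \<open>K\<close> of \<open>U\<close>, a basis of \<open>U / K\<close> is given by representatives in \<open>U\<close>, and
  \<open>quot_trace U K T\<close> is the trace of the endomorphism of \<open>U / K\<close> induced by a linear map \<open>T\<close>
  on \<open>U\<close> with \<open>T ` K \<subseteq> K\<close>. It does not depend on the chosen basis.
\<close>

definition quot_coords ::
  "('k \<Rightarrow> complex) set \<Rightarrow> ('k \<Rightarrow> complex) set \<Rightarrow> ('k \<Rightarrow> complex) \<Rightarrow> (('k \<Rightarrow> complex) \<Rightarrow> complex) \<Rightarrow> bool"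
  where
  "quot_coords K B u c \<longleftrightarrow> (\<forall>e. e \<notin> B \<longrightarrow> c e = 0) \<and> u - (\<Sum>e\<in>B. c e *\<^sub>C e) \<in> K"

definition quot_basis ::
  "('k \<Rightarrow> complex) set \<Rightarrow> ('k \<Rightarrow> complex) set \<Rightarrow> ('k \<Rightarrow> complex) set \<Rightarrow> bool" where
  "quot_basis U K B \<longleftrightarrow> finite B \<and> B \<subseteq> U \<and> (\<forall>u\<in>U. \<exists>!c. quot_coords K B u c)"

definition quot_trace ::
  "('k \<Rightarrow> complex) set \<Rightarrow> ('k \<Rightarrow> complex) set \<Rightarrow> (('k \<Rightarrow> complex) \<Rightarrow> 'k \<Rightarrow> complex) \<Rightarrow> complex" where
  "quot_trace U K T =
     (let B = (SOME B. quot_basis U K B) in \<Sum>e\<in>B. (THE c. quot_coords K B (T e) c) e)"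

text \<open>
  A one-dimensional representation \<open>\<rho>\<close> of the stabilizer lives on the space \<open>complex\<close>. Over
  \<open>complex\<close> the tensor product of the group algebra with this space is the space of functions
  supported on \<open>Cyc n\<close>, with \<open>c \<otimes> v\<close> equal to \<open>v *\<^sub>C ket c\<close>; the tensor product over the group
  algebra of the stabilizer is its quotient by the span of the elements
  \<open>ch \<otimes> v - c \<otimes> \<rho>(h)v\<close>.
\<close>

definition tensor_relations :: "nat \<Rightarrow> perm \<Rightarrow> (perm \<Rightarrow> complex) \<Rightarrow> (perm \<Rightarrow> complex) set" where
  "tensor_relations n x \<rho> = cfun.span
     {v *\<^sub>C ket (c \<circ> h) - (\<rho> h * v) *\<^sub>C ket c | c h v. c \<in> Cyc n \<and> h \<in> stab n x}"

definition J_act :: "nat \<Rightarrow> perm \<Rightarrow> (idx \<Rightarrow> complex) \<Rightarrow> (perm \<Rightarrow> complex) \<Rightarrow> perm \<Rightarrow> complex" where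
  "J_act n x f u = (\<Sum>(y, b)\<in>J_basis n. \<Sum>c\<in>Cyc n.
     (f (y, b) * u c) *\<^sub>C (if right_act n y (b \<circ> c) = x then ket (b \<circ> c) else 0))"

definition induced_char :: "nat \<Rightarrow> perm \<Rightarrow> (perm \<Rightarrow> complex) \<Rightarrow> (idx \<Rightarrow> complex) \<Rightarrow> complex" where
  "induced_char n x \<rho> f = quot_trace (free_space (Cyc n)) (tensor_relations n x \<rho>) (J_act n x f)"

definition nonzero_complex :: "complex monoid" where
  "nonzero_complex = \<lparr>carrier = UNIV - {0}, mult = (*), one = 1\<rparr>"

definition primitive_root_of_unity :: "nat \<Rightarrow> complex \<Rightarrow> bool" where
  "primitive_root_of_unity m \<zeta> \<longleftrightarrow> m > 0 \<and> \<zeta> ^ m = 1 \<and> (\<forall>k. 0 < k \<and> k < m \<longrightarrow> \<zeta> ^ k \<noteq> 1)"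

end

(*
  By the explicit form of the integral, nu is 1/n times the sum, over all z and r with
  z <| a^r = z^-1, of the trace of p_(z^-1) # a^(z(r)+r). On the induced module only z in the
  orbit of x contributes. For z = x <| a^p the solutions are r = s + x(p) - p + jt with
  0 <= j < n/t, and then z(r) + r = (u2 + j u1) t independently of p. So nu is zeta^(i u2) times
  the mean of the powers of zeta^(i u1), which is 1 or 0. As x fixes x(s) + s modulo n, evaluating
  x at u2 t gives 2 u2 = u1 u2 modulo n/t; hence zeta^(i u2) is a sign if zeta^(i u1) = 1.
*)

theory Submission
  imports Defs
begin

section \<open>Rotations and the right action\<close>

text \<open>Inversion permutes the orbit by x <| a^p |-> x <| a^(s + x(p)). Both divisibility claims
  come from this rule: the exponents t and 0 name the same orbit element, so t divides x(t);
  inverting twice returns to x, so t divides x(s) + s. The computation yields zeta^(i u2), whereas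
  the statement has zeta^(-i u2); the two agree because the value is a sign whenever zeta^(i u1) =
  1. For odd n/t this sign must be 1, since it is also an (n/t)-th root of unity. On the module side
  the obstacle is that the induced module is a quotient whose trace is taken in a basis picked by
  \<open>SOME\<close>. It is overcome by explicit functionals that vanish on the tensor relations
  and are dual to the classes of a^q with 0 <= q < t.\<close>

lemma rot_eq_iff:
  assumes "n > 0"
  shows "rot n r = rot n q \<longleftrightarrow> [r = q] (mod int n)"
proof
  assume "rot n r = rot n q"
  from fun_cong[OF this, of 0] show "[r = q] (mod int n)"
    using assms by (simp add: rot_def cong_def)
qed (metis cong_def rot_mod(1))

lemma rot_in_Cyc: "n > 0 \<Longrightarrow> rot n r \<in> Cyc n"
  by (simp add: Cyc_eq)

lemma bij_betw_rot_Cyc: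
  assumes "n > 0"
  shows "bij_betw (rot n) {0..<int n} (Cyc n)"
proof -
  have "inj_on (rot n) {0..<int n}"
    using assms by (auto simp: inj_on_def rot_eq_iff cong_def)
  moreover have "rot n r \<in> rot n ` {0..<int n}" for r
    using assms by (intro image_eqI[where x = "r mod int n"]) (simp_all add: rot_mod)
  ultimately show ?thesis
    using assms by (auto simp: bij_betw_def Cyc_eq)
qed

lemma card_Cyc: "n > 0 \<Longrightarrow> card (Cyc n) = n"
  using bij_betw_same_card[OF bij_betw_rot_Cyc] by fastforce

lemma Sym1_permutes: "x \<in> Sym1 n \<Longrightarrow> x permutes {0..<int n}"
  by (simp add: Sym1_def SymZ_def)

lemma Sym1_range:
  assumes "n > 0" "x \<in> Sym1 n"
  shows "x (r mod int n) \<in> {0..<int n}"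
  using assms Sym1_permutes permutes_in_image[of x "{0..<int n}" "r mod int n"] by simp

lemma Sym1_value_mod:
  assumes "n > 0" "x \<in> Sym1 n"
  shows "x (r mod int n) mod int n = x (r mod int n)"
  using Sym1_range[OF assms, of r] by simp

lemma inv_SymZ:
  assumes "x \<in> carrier (SymZ n)"
  shows "inv\<^bsub>SymZ n\<^esub> x \<circ> x = id" "x \<circ> inv\<^bsub>SymZ n\<^esub> x = id"
  using group.l_inv[OF group_SymZ assms] group.r_inv[OF group_SymZ assms]
  by (simp_all add: SymZ_def)

lemma inv_Sym1:
  assumes "x \<in> Sym1 n"
  shows "inv\<^bsub>SymZ n\<^esub> x \<in> Sym1 n"
proof -
  have x: "x \<in> carrier (SymZ n)" "x 0 = 0"
    using assms by (simp_all add: Sym1_def)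
  have "(inv\<^bsub>SymZ n\<^esub> x) (x 0) = 0"
    using fun_cong[OF inv_SymZ(1)[OF x(1)], of 0] by simp
  thus ?thesis
    using x group.inv_closed[OF group_SymZ x(1)] by (simp add: Sym1_def)
qed

lemma inv_Sym1_value:
  assumes "x \<in> Sym1 n"
  shows "(inv\<^bsub>SymZ n\<^esub> x) (x r) = r"
  using fun_cong[OF inv_SymZ(1), of x n r] assms by (simp add: Sym1_def)

lemma inv_inv_Sym1:
  assumes "x \<in> Sym1 n"
  shows "inv\<^bsub>SymZ n\<^esub> (inv\<^bsub>SymZ n\<^esub> x) = x"
  using assms group.inv_inv[OF group_SymZ] by (simp add: Sym1_def)

lemma left_act_rot:
  assumes "n > 0" "x \<in> Sym1 n"
  shows "left_act n x (rot n r) = rot n (x (r mod int n))"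
  using assms by (simp add: left_act_def factorization_eq)

lemma right_act_rot:
  assumes "n > 0" "x \<in> Sym1 n"
  shows "right_act n x (rot n r) = rot n (- x (r mod int n)) \<circ> x \<circ> rot n r"
  using assms by (simp add: right_act_def factorization_eq)

lemma right_act_value:
  assumes "n > 0" "x \<in> Sym1 n"
  shows "right_act n x (rot n r) (q mod int n)
    = (x ((q + r) mod int n) - x (r mod int n)) mod int n"
  using assms Sym1_range[OF assms, of "q + r"]
  by (simp add: right_act_rot) (simp add: rot_def mod_add_left_eq)

text \<open>The correcting exponents x(r) and (x <| a^r)(q) = x(q + r) - x(r) telescope to x(q +
  r).\<close>

lemma right_act_add:
  assumes n: "n > 0" and x: "x \<in> Sym1 n"
  shows "right_act n (right_act n x (rot n r)) (rot n q) = right_act n x (rot n (r + q))"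
proof -
  let ?y = "right_act n x (rot n r)"
  have "right_act n ?y (rot n q)
      = rot n (- (x ((q + r) mod int n) - x (r mod int n))) \<circ> ?y \<circ> rot n q"
    using right_act_in_Sym1[OF n x, of r]
    by (simp only: right_act_rot[OF n, of ?y] right_act_value[OF n x] rot_mod)
  also have "\<dots> = (rot n (- (x ((q + r) mod int n) - x (r mod int n))) \<circ> rot n (- x (r mod int n)))
      \<circ> x \<circ> (rot n r \<circ> rot n q)"
    by (simp only: right_act_rot[OF n x] comp_assoc)
  also have "\<dots> = right_act n x (rot n (r + q))"
    by (simp only: right_act_rot[OF n x] rot_comp[OF n]) (simp add: add.commute)
  finally show ?thesis .
qed

lemma right_act_0:
  assumes "n > 0" "x \<in> Sym1 n"
  shows "right_act n x (rot n 0) = x"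
  using assms by (simp add: right_act_rot) (simp add: Sym1_def rot_0)

text \<open>Inverting \<open>x a\<^sup>r = (x \<rhd> a\<^sup>r)(x \<lhd> a\<^sup>r)\<close> gives a factorization of \<open>x\<^sup>-\<^sup>1 (x \<rhd> a\<^sup>r)\<close>.\<close>

lemma inv_right_act:
  assumes n: "n > 0" and x: "x \<in> Sym1 n"
  shows "inv\<^bsub>SymZ n\<^esub> (right_act n x (rot n r))
    = right_act n (inv\<^bsub>SymZ n\<^esub> x) (rot n (x (r mod int n)))"
proof (rule group.inv_equality[OF group_SymZ])
  let ?y = "inv\<^bsub>SymZ n\<^esub> x" and ?k = "x (r mod int n)"
  have "right_act n ?y (rot n ?k) = rot n (- (r mod int n)) \<circ> ?y \<circ> rot n ?k"
    by (simp only: right_act_rot[OF n inv_Sym1[OF x]] Sym1_value_mod[OF n x] inv_Sym1_value[OF x])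
  hence "right_act n ?y (rot n ?k) \<circ> right_act n x (rot n r)
      = rot n (- r) \<circ> (?y \<circ> ((rot n ?k \<circ> rot n (- ?k)) \<circ> x)) \<circ> rot n r"
    by (simp only: right_act_rot[OF n x] rot_mod comp_assoc)
  also have "\<dots> = id"
    using x by (simp only: rot_comp[OF n]) (simp add: rot_0 Sym1_def inv_SymZ rot_comp[OF n])
  finally show "right_act n ?y (rot n ?k) \<otimes>\<^bsub>SymZ n\<^esub> right_act n x (rot n r) = \<one>\<^bsub>SymZ n\<^esub>"
    by (simp add: SymZ_def)
qed (use right_act_in_Sym1[OF n] x inv_Sym1 in \<open>auto simp: Sym1_def\<close>)

section \<open>Traces on quotients and the integral\<close>

lemma subspace_free_space: "cfun.subspace (free_space B)"
  by (auto simp: cfun.subspace_def free_space_def cscale_def)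

lemma ket_in_free_space: "k \<in> B \<Longrightarrow> ket k \<in> free_space B"
  by (auto simp: free_space_def ket_def)

lemma free_space_expand:
  assumes "finite B" "u \<in> free_space B"
  shows "u = (\<Sum>k\<in>B. u k *\<^sub>C ket k)"
proof
  fix j
  have "(\<Sum>k\<in>B. u k *\<^sub>C ket k) j = (\<Sum>k\<in>B. if k = j then u j else 0)"
    unfolding sum_fun_apply by (intro sum.cong) (auto simp: cscale_def ket_def)
  also have "\<dots> = u j"
    using assms by (auto simp: free_space_def)
  finally show "u j = (\<Sum>k\<in>B. u k *\<^sub>C ket k) j" ..
qed

text \<open>Evaluates maps extended linearly from a basis, such as \<open>mult_tensor\<close> and
  \<open>J_act\<close>, on a combination of kets. As \<open>P\<close> may repeat values, the sums
  are exchanged rather than reindexed.\<close>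

lemma sum_ket_combination:
  assumes "finite S" "P ` A \<subseteq> S"
  shows "(\<Sum>k\<in>S. (\<Sum>a\<in>A. c a *\<^sub>C ket (P a)) k *\<^sub>C g k) = (\<Sum>a\<in>A. c a *\<^sub>C g (P a))"
proof -
  have "(\<Sum>k\<in>S. (\<Sum>a\<in>A. c a *\<^sub>C ket (P a)) k *\<^sub>C g k)
      = (\<Sum>k\<in>S. \<Sum>a\<in>A. if k = P a then c a *\<^sub>C g k else 0)"
    by (intro sum.cong refl)
       (auto simp: sum_fun_apply sum_distrib_right cscale_def ket_def fun_eq_iff intro!: sum.cong)
  also have "\<dots> = (\<Sum>a\<in>A. \<Sum>k\<in>S. if k = P a then c a *\<^sub>C g k else 0)"
    by (rule sum.swap)
  also have "\<dots> = (\<Sum>a\<in>A. c a *\<^sub>C g (P a))"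
    using assms by (intro sum.cong refl) auto
  finally show ?thesis .
qed

text \<open>
  Here \<open>\<phi>\<close> is the family of coordinate functionals of the basis \<open>b\<close> of \<open>U / K\<close>; the trace
  is then independent of the basis that \<open>SOME\<close> picks.
\<close>

lemma quot_trace_eq:
  fixes U K :: "('k \<Rightarrow> complex) set" and b :: "'i \<Rightarrow> 'k \<Rightarrow> complex"
  assumes K: "cfun.subspace K" and I: "finite I" and b: "b ` I \<subseteq> U"
    and \<phi>: "\<And>i. i \<in> I \<Longrightarrow> Vector_Spaces.linear cscale (*) (\<phi> i)"
    and \<phi>K: "\<And>i u. i \<in> I \<Longrightarrow> u \<in> K \<Longrightarrow> \<phi> i u = 0"
    and \<phi>b: "\<And>i j. i \<in> I \<Longrightarrow> j \<in> I \<Longrightarrow> \<phi> i (b j) = (if i = j then 1 else 0)"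
    and exp: "\<And>u. u \<in> U \<Longrightarrow> u - (\<Sum>i\<in>I. \<phi> i u *\<^sub>C b i) \<in> K"
    and T: "Vector_Spaces.linear cscale cscale T" and TU: "T ` U \<subseteq> U" and TK: "T ` K \<subseteq> K"
  shows "quot_trace U K T = (\<Sum>i\<in>I. \<phi> i (T (b i)))"
proof -
  interpret T: Vector_Spaces.linear cscale cscale T by (fact T)
  have inj: "inj_on b I"
    using \<phi>b by (metis (full_types) inj_onI zero_neq_one)
  \<comment> \<open>Some basis must exist before anything is known about the one that
    \<open>SOME\<close> picks.\<close>
  have "quot_basis U K (b ` I)"
    unfolding quot_basis_def
  proof (intro conjI ballI ex1I)
    fix u assume u: "u \<in> U"
    let ?c = "\<lambda>e. if e \<in> b ` I then \<phi> (inv_into I b e) u else 0"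
    have c: "(\<Sum>e\<in>b ` I. ?c e *\<^sub>C e) = (\<Sum>i\<in>I. \<phi> i u *\<^sub>C b i)"
      using inj by (simp add: sum.reindex)
    show "quot_coords K (b ` I) u ?c"
      unfolding quot_coords_def c using exp[OF u] by simp
    fix d assume d: "quot_coords K (b ` I) u d"
    have "d (b i) = \<phi> i u" if i: "i \<in> I" for i
    proof -
      interpret \<phi>: Vector_Spaces.linear cscale "(*)" "\<phi> i" by (fact \<phi>[OF i])
      have "u - (\<Sum>j\<in>I. d (b j) *\<^sub>C b j) \<in> K"
        using d inj by (simp add: quot_coords_def sum.reindex)
      hence "\<phi> i (u - (\<Sum>j\<in>I. d (b j) *\<^sub>C b j)) = 0"
        using \<phi>K i by blast
      hence "\<phi> i u = (\<Sum>j\<in>I. d (b j) * \<phi> i (b j))"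
        by (simp add: \<phi>.diff \<phi>.sum \<phi>.scale)
      also have "\<dots> = (\<Sum>j\<in>I. if i = j then d (b j) else 0)"
        using i by (intro sum.cong) (auto simp: \<phi>b)
      finally show ?thesis
        using i I by simp
    qed
    thus "d = ?c"
      using d inj by (auto simp: quot_coords_def fun_eq_iff)
  qed (use I b in auto)
  hence "\<exists>B. quot_basis U K B" ..
  define B where "B = (SOME B. quot_basis U K B)"
  have "quot_basis U K B"
    unfolding B_def using someI_ex[OF \<open>\<exists>B. quot_basis U K B\<close>] .
  hence B: "B \<subseteq> U" and ex1: "\<And>u. u \<in> U \<Longrightarrow> \<exists>!c. quot_coords K B u c"
    by (auto simp: quot_basis_def)
  define \<psi> where "\<psi> u = (THE c. quot_coords K B u c)" for u
  have \<psi>: "quot_coords K B u (\<psi> u)" if "u \<in> U" for u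
    unfolding \<psi>_def using theI'[OF ex1[OF that]] .
  have Tb: "T (b i) \<in> U" if "i \<in> I" for i
    using that b TU by blast
  \<comment> \<open>\<open>T\<close> descends to the quotient, so the coordinates of
    \<open>T e\<close> in the chosen basis are linear in the coordinates \<open>\<phi> i e\<close>
    of \<open>e\<close>; the error of expanding \<open>e\<close> stays in \<open>K\<close>.\<close>
  have coords: "\<psi> (T e) f = (\<Sum>i\<in>I. \<phi> i e * \<psi> (T (b i)) f)" if e: "e \<in> B" for e f
  proof -
    let ?c = "\<lambda>f. \<Sum>i\<in>I. \<phi> i e * \<psi> (T (b i)) f"
    have "T e - (\<Sum>f\<in>B. ?c f *\<^sub>C f) = T (e - (\<Sum>i\<in>I. \<phi> i e *\<^sub>C b i))
        + (\<Sum>i\<in>I. \<phi> i e *\<^sub>C (T (b i) - (\<Sum>f\<in>B. \<psi> (T (b i)) f *\<^sub>C f)))"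
      by (simp add: T.diff T.sum T.scale cfun.scale_right_diff_distrib cfun.scale_sum_right
            cfun.scale_sum_left sum_subtractf sum.swap[of _ I B])
    also have "\<dots> \<in> K"
    proof (intro cfun.subspace_add[OF K] cfun.subspace_sum[OF K] cfun.subspace_scale[OF K])
      show "T (e - (\<Sum>i\<in>I. \<phi> i e *\<^sub>C b i)) \<in> K"
        using exp e B TK by blast
      show "T (b i) - (\<Sum>f\<in>B. \<psi> (T (b i)) f *\<^sub>C f) \<in> K" if "i \<in> I" for i
        using \<psi>[OF Tb[OF that]] by (simp add: quot_coords_def)
    qed
    finally have "quot_coords K B (T e) ?c"
      using \<psi>[OF Tb] by (auto simp: quot_coords_def intro!: sum.neutral)
    moreover have "T e \<in> U"
      using e B TU by blast
    ultimately have "\<psi> (T e) = ?c"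
      using \<psi> ex1 by blast
    thus ?thesis by simp
  qed
  have "quot_trace U K T = (\<Sum>e\<in>B. \<psi> (T e) e)"
    by (simp add: quot_trace_def B_def \<psi>_def Let_def)
  \<comment> \<open>This is the trace of a product of two rectangular matrices, indexed by
    \<open>B\<close> and \<open>I\<close>; exchanging the sums is the cyclicity of the
    trace.\<close>
  also have "\<dots> = (\<Sum>e\<in>B. \<Sum>i\<in>I. \<phi> i e * \<psi> (T (b i)) e)"
    by (intro sum.cong refl) (simp add: coords)
  also have "\<dots> = (\<Sum>i\<in>I. \<Sum>e\<in>B. \<phi> i e * \<psi> (T (b i)) e)"
    by (rule sum.swap)
  also have "\<dots> = (\<Sum>i\<in>I. \<phi> i (T (b i)))"
  proof (intro sum.cong refl)
    fix i assume i: "i \<in> I"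
    interpret \<phi>: Vector_Spaces.linear cscale "(*)" "\<phi> i" by (fact \<phi>[OF i])
    have "\<phi> i (T (b i) - (\<Sum>e\<in>B. \<psi> (T (b i)) e *\<^sub>C e)) = 0"
      using \<psi>[OF Tb[OF i]] \<phi>K[OF i] by (simp add: quot_coords_def)
    thus "(\<Sum>e\<in>B. \<phi> i e * \<psi> (T (b i)) e) = \<phi> i (T (b i))"
      by (simp add: \<phi>.diff \<phi>.sum \<phi>.scale mult.commute)
  qed
  finally show ?thesis .
qed

section \<open>The product of the two coproduct components of the integral\<close>

lemma J_integral_eq:
  assumes "n > 0"
  shows "J_integral n = (\<lambda>(y, b). if y = id \<and> b \<in> Cyc n then 1 / of_nat n else 0)"
  unfolding J_integral_def
  using the1_equality[OF normalized_integral_ex1[OF assms], OF normalized_integral_explicit[OF assms]]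
  unfolding card_Cyc[OF assms] .

text \<open>The integral is supported on y = 1, so the first component y z^-1 of the coproduct
  becomes z^-1.\<close>

lemma J_comult_integral:
  assumes n: "n > 0"
  shows "J_comult n (J_integral n) = (\<Sum>(z, b)\<in>J_basis n.
    (1 / of_nat n) *\<^sub>C ket ((inv\<^bsub>SymZ n\<^esub> z, left_act n z b), (z, b)))"
proof -
  have id1: "id \<in> Sym1 n"
    by (simp add: Sym1_def SymZ_def permutes_id)
  have "J_comult n (J_integral n) = (\<Sum>y\<in>Sym1 n. \<Sum>b\<in>Cyc n. J_integral n (y, b) *\<^sub>C
     (\<Sum>z\<in>Sym1 n. ket ((y \<circ> inv\<^bsub>SymZ n\<^esub> z, left_act n z b), (z, b))))"
    unfolding J_comult_def J_basis_def by (simp add: sum.cartesian_product)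
  also have "\<dots> = (\<Sum>y\<in>Sym1 n. if y = id then \<Sum>b\<in>Cyc n. \<Sum>z\<in>Sym1 n. (1 / of_nat n) *\<^sub>C
       ket ((inv\<^bsub>SymZ n\<^esub> z, left_act n z b), (z, b)) else 0)"
    by (intro sum.cong refl)
       (auto simp: J_integral_eq[OF n] cfun.scale_sum_right intro!: sum.neutral)
  also have "\<dots> = (\<Sum>b\<in>Cyc n. \<Sum>z\<in>Sym1 n. (1 / of_nat n) *\<^sub>C
       ket ((inv\<^bsub>SymZ n\<^esub> z, left_act n z b), (z, b)))"
    using id1 finite_J_basis[OF n] by simp
  also have "\<dots> = (\<Sum>z\<in>Sym1 n. \<Sum>b\<in>Cyc n. (1 / of_nat n) *\<^sub>C
       ket ((inv\<^bsub>SymZ n\<^esub> z, left_act n z b), (z, b)))"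
    by (rule sum.swap)
  finally show ?thesis
    unfolding J_basis_def by (simp add: sum.cartesian_product)
qed

definition fs_index :: "nat \<Rightarrow> idx set" where
  "fs_index n = {(z, b) \<in> J_basis n. right_act n z b = inv\<^bsub>SymZ n\<^esub> z}"

text \<open>
  The product \<open>(p\<^bsub>z\<^sup>-\<^sup>1\<^esub> # (z \<rhd> b)) (p\<^sub>z # b)\<close> is nonzero only if \<open>z = z\<^sup>-\<^sup>1 \<lhd> (z \<rhd> b) = (z \<lhd> b)\<^sup>-\<^sup>1\<close>.
\<close>

lemma mult_tensor_integral:
  assumes n: "n > 0"
  shows "mult_tensor n (J_comult n (J_integral n)) = (\<Sum>(z, b)\<in>fs_index n.
    (1 / of_nat n) *\<^sub>C ket (inv\<^bsub>SymZ n\<^esub> z, left_act n z b \<circ> b))"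
proof -
  let ?P = "\<lambda>(z, b). ((inv\<^bsub>SymZ n\<^esub> z, left_act n z b), (z, b))"
  have fin: "finite (J_basis n)"
    using finite_J_basis[OF n] by (simp add: J_basis_def)
  have P: "?P ` J_basis n \<subseteq> J_basis n \<times> J_basis n"
    using n by (auto simp: J_basis_def inv_Sym1 Cyc_eq left_act_rot)
  have "mult_tensor n (J_comult n (J_integral n)) = (\<Sum>k\<in>J_basis n \<times> J_basis n.
      (\<Sum>a\<in>J_basis n. (1 / of_nat n) *\<^sub>C ket (?P a)) k *\<^sub>C mult_basis n (fst k) (snd k))"
    unfolding mult_tensor_def J_comult_integral[OF n] by (simp add: case_prod_unfold)
  also have "\<dots> = (\<Sum>a\<in>J_basis n. (1 / of_nat n) *\<^sub>C mult_basis n (fst (?P a)) (snd (?P a)))"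
    using fin by (intro sum_ket_combination[OF _ P]) auto
  also have "\<dots> = (\<Sum>a\<in>J_basis n. if right_act n (fst a) (snd a) = inv\<^bsub>SymZ n\<^esub> (fst a)
      then (1 / of_nat n) *\<^sub>C ket (inv\<^bsub>SymZ n\<^esub> (fst a), left_act n (fst a) (snd a) \<circ> snd a) else 0)"
  proof (intro sum.cong refl)
    fix a assume a: "a \<in> J_basis n"
    then obtain z r where zr: "a = (z, rot n r)" and z: "z \<in> Sym1 n"
      using n by (auto simp: J_basis_def Cyc_eq)
    have "z = right_act n (inv\<^bsub>SymZ n\<^esub> z) (left_act n z (rot n r)) \<longleftrightarrow>
        z = inv\<^bsub>SymZ n\<^esub> (right_act n z (rot n r))"
      by (simp add: left_act_rot[OF n z] inv_right_act[OF n z])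
    also have "\<dots> \<longleftrightarrow> right_act n z (rot n r) = inv\<^bsub>SymZ n\<^esub> z"
      using inv_inv_Sym1 z right_act_in_Sym1[OF n z] by metis
    finally show "(1 / of_nat n) *\<^sub>C mult_basis n (fst (?P a)) (snd (?P a)) =
      (if right_act n (fst a) (snd a) = inv\<^bsub>SymZ n\<^esub> (fst a)
      then (1 / of_nat n) *\<^sub>C ket (inv\<^bsub>SymZ n\<^esub> (fst a), left_act n (fst a) (snd a) \<circ> snd a) else 0)"
      by (simp add: zr mult_basis_def)
  qed
  also have "\<dots> = (\<Sum>(z, b)\<in>fs_index n.
    (1 / of_nat n) *\<^sub>C ket (inv\<^bsub>SymZ n\<^esub> z, left_act n z b \<circ> b))"
    unfolding fs_index_def using fin
    by (subst sum.inter_filter[symmetric]) (simp_all add: case_prod_unfold)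
  finally show ?thesis .
qed

section \<open>The action before passing to the quotient\<close>

lemma J_act_alt:
  "J_act n x f u = (\<Sum>k\<in>J_basis n. f k *\<^sub>C (\<Sum>c\<in>Cyc n. u c *\<^sub>C
     (if right_act n (fst k) (snd k \<circ> c) = x then ket (snd k \<circ> c) else 0)))"
  by (simp add: J_act_def case_prod_unfold cfun.scale_sum_right)

lemma linear_J_act: "Vector_Spaces.linear cscale cscale (J_act n x f)"
  by unfold_locales
     (simp_all add: J_act_def case_prod_unfold cscale_def fun_eq_iff sum_fun_apply
        algebra_simps sum.distrib sum_distrib_left)

lemma J_act_in_free_space:
  assumes n: "n > 0"
  shows "J_act n x f u \<in> free_space (Cyc n)"
proof -
  have "ket (b \<circ> c) \<in> free_space (Cyc n)" if "b \<in> Cyc n" "c \<in> Cyc n" for b c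
    using that n by (intro ket_in_free_space) (auto simp: Cyc_eq rot_comp)
  thus ?thesis
    using cfun.subspace_0[OF subspace_free_space]
    unfolding J_act_def case_prod_unfold
    by (intro cfun.subspace_sum[OF subspace_free_space] cfun.subspace_scale[OF subspace_free_space])
       (auto simp: J_basis_def)
qed

lemma J_act_ket:
  assumes "n > 0" "c \<in> Cyc n"
  shows "J_act n x f (ket c) = (\<Sum>k\<in>J_basis n. f k *\<^sub>C
     (if right_act n (fst k) (snd k \<circ> c) = x then ket (snd k \<circ> c) else 0))"
proof -
  have "(\<Sum>d\<in>Cyc n. ket c d *\<^sub>C g d) = g c" for g :: "perm \<Rightarrow> perm \<Rightarrow> complex"
  proof -
    have "(\<Sum>d\<in>Cyc n. ket c d *\<^sub>C g d) = (\<Sum>d\<in>Cyc n. if d = c then g d else 0)"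
      by (intro sum.cong) (auto simp: ket_def)
    thus ?thesis
      using assms finite_J_basis[OF assms(1)] by simp
  qed
  thus ?thesis
    unfolding J_act_alt by simp
qed

section \<open>The orbit of a permutation containing its inverse\<close>

text \<open>The induction runs in both directions because the multiples of t that occur may be
  negative.\<close>

lemma cong_mult_of_additive:
  fixes f :: "int \<Rightarrow> int"
  assumes "f 0 = 0" "\<And>j. [f (j + 1) = f j + c] (mod m)"
  shows "[f j = j * c] (mod m)"
proof (induction j rule: int_induct[where k = 0])
  case base
  show ?case using assms by simp
next
  case (step1 j)
  have "[f (j + 1) = j * c + c] (mod m)"
    using cong_trans[OF assms(2) cong_add[OF step1(2) cong_refl]] .
  thus ?case by (simp add: algebra_simps)
next
  case (step2 j)
  have "[f (j - 1) + c = f j] (mod m)"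
    using cong_sym[OF assms(2)[of "j - 1"]] by simp
  hence "[f (j - 1) + c = (j - 1) * c + c] (mod m)"
    using cong_trans[OF _ step2(2)] by (simp add: algebra_simps)
  thus ?case using cong_add_rcancel by blast
qed

lemma sum_root_of_unity_powers:
  fixes w :: complex
  assumes "w ^ m = 1"
  shows "(\<Sum>j<m. w ^ j) = (if w = 1 then of_nat m else 0)"
  using assms by (auto simp: sum_gp_strict)

text \<open>The condition F_x = <a^t> with t minimal enters through what it yields: t divides n, and
  a^r fixes x exactly when t divides r.\<close>

locale inverse_orbit =
  fixes n t :: nat and x :: perm and s :: int
  assumes n_pos: "n > 0" and x: "x \<in> Sym1 n"
    and t_pos: "t > 0" and t_dvd: "t dvd n"
    and act_eq_self_iff: "right_act n x (rot n r) = x \<longleftrightarrow> int t dvd r"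
    and inv_x: "inv\<^bsub>SymZ n\<^esub> x = right_act n x (rot n s)"
begin

abbreviation m :: nat where "m \<equiv> n div t"

abbreviation X :: "int \<Rightarrow> int" where "X r \<equiv> x (r mod int n)"

abbreviation orb :: "int \<Rightarrow> perm" where "orb r \<equiv> right_act n x (rot n r)"

lemma n_eq: "n = t * m"
  using t_dvd by simp

lemma m_pos: "m > 0"
  using n_pos n_eq by (metis gr0I mult_0_right)

lemma orb_in_Sym1: "orb r \<in> Sym1 n"
  using right_act_in_Sym1[OF n_pos x] .

lemma orb_act: "right_act n (orb p) (rot n r) = orb (p + r)"
  using right_act_add[OF n_pos x] .

lemma orb_eq_iff: "orb p = orb q \<longleftrightarrow> int t dvd p - q"
proof
  assume "orb p = orb q"
  hence "right_act n (orb p) (rot n (- q)) = right_act n (orb q) (rot n (- q))"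
    by simp
  thus "int t dvd p - q"
    by (simp add: orb_act right_act_0[OF n_pos x] act_eq_self_iff)
next
  assume "int t dvd p - q"
  hence "right_act n (orb (p - q)) (rot n q) = right_act n x (rot n q)"
    using act_eq_self_iff[of "p - q"] by simp
  thus "orb p = orb q"
    by (simp add: orb_act)
qed

text \<open>By \<open>inv_right_act\<close> this inverse is x^-1 <| a^(x(p)), and x^-1 itself has
  exponent s.\<close>

lemma inv_orb: "inv\<^bsub>SymZ n\<^esub> (orb p) = orb (s + X p)"
  by (simp add: inv_right_act[OF n_pos x] inv_x right_act_add[OF n_pos x])

lemma dvd_mod_n: "[a = b] (mod int n) \<Longrightarrow> int t dvd a \<longleftrightarrow> int t dvd b"
  using cong_dvd_modulus[of a b "int n" "int t"] t_dvd cong_dvd_iff by auto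

lemma x_0: "x 0 = 0"
  using x by (simp add: Sym1_def)

lemma orb_value: "[orb p (r mod int n) = X (p + r) - X p] (mod int n)"
  by (simp add: right_act_value[OF n_pos x] add.commute cong_def)

text \<open>As a^d fixes x, reading x <| a^d = x at the point q gives x(d + q) - x(d) =
  x(q).\<close>

lemma X_add:
  assumes "int t dvd d"
  shows "[X (q + d) = X q + X d] (mod int n)"
proof -
  have "[X q = X (d + q) - X d] (mod int n)"
    using orb_value[of d q] assms by (simp add: act_eq_self_iff[THEN iffD2])
  from cong_add[OF cong_sym[OF this] cong_refl[of "X d"]] show ?thesis
    by (simp add: add.commute)
qed

lemma X_mult_t: "[X (j * int t) = j * X (int t)] (mod int n)"
proof (rule cong_mult_of_additive)
  show "[X ((j + 1) * int t) = X (j * int t) + X (int t)] (mod int n)" for j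
    using X_add[of "int t" "j * int t"] by (simp add: algebra_simps)
qed (simp add: x_0)

text \<open>The equation x^-1 = x <| a^s evaluated at the point x(q). The case q = s says that x(s)
  + s is a fixed point of x.\<close>

lemma X_s_X: "[X (s + X q) = X s + q] (mod int n)"
proof -
  have "[q = X (s + X q) - X s] (mod int n)"
  proof -
    have "orb s (X q mod int n) = q mod int n"
      using inv_Sym1_value[OF x, of "q mod int n"]
      by (simp only: Sym1_value_mod[OF n_pos x] inv_x)
    thus ?thesis
      using orb_value[of s "X q"] by (simp add: cong_def)
  qed
  from cong_add[OF cong_sym[OF this] cong_refl[of "X s"]] show ?thesis
    by (simp add: add.commute)
qed

text \<open>The elements with exponents t and 0 coincide, hence so do their inverses, with exponents
  s + x(t) and s.\<close>

lemma dvd_X_t: "int t dvd X (int t)"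
proof -
  have "orb (s + X (int t)) = orb s"
    using inv_orb[of "int t"] act_eq_self_iff[of "int t"] inv_x by simp
  thus ?thesis
    by (simp add: orb_eq_iff)
qed

text \<open>Inverting x twice leads from exponent 0 to s and on to s + x(s), which must again give
  x.\<close>

lemma dvd_X_s: "int t dvd X s + s"
proof -
  have "orb (s + X s) = x"
    using inv_orb[of s] inv_inv_Sym1[OF x] inv_x by simp
  thus ?thesis
    by (simp add: act_eq_self_iff add.commute)
qed

lemma exists_multiples:
  "\<exists>u\<^sub>1. [X (int t) + int t = u\<^sub>1 * int t] (mod int n)"
  "\<exists>u\<^sub>2. [X s + s = u\<^sub>2 * int t] (mod int n)"
proof -
  have "int t dvd X (int t) + int t"
    using dvd_X_t by simp
  thus "\<exists>u\<^sub>1. [X (int t) + int t = u\<^sub>1 * int t] (mod int n)"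
    "\<exists>u\<^sub>2. [X s + s = u\<^sub>2 * int t] (mod int n)"
    using dvd_X_s by (metis cong_refl dvdE mult.commute)+
qed

section \<open>Coordinates and character of the induced module\<close>

context
  fixes \<rho> :: "perm \<Rightarrow> complex" and \<omega> :: complex
  assumes stab_eq: "stab n x = range (\<lambda>k. rot n (k * int t))"
    and \<rho>: "\<rho> (rot n (k * int t)) = \<omega> powi k"
    and \<omega>: "\<omega> ^ m = 1"
begin

lemma \<omega>_nonzero: "\<omega> \<noteq> 0"
  using \<omega> m_pos by (auto simp: power_0_left)

text \<open>Modulo \<open>m\<close> is exactly the precision to which their defining congruences
  determine u1 and u2.\<close>

lemma powi_cong:
  assumes "[j = k] (mod int m)"
  shows "\<omega> powi j = \<omega> powi k"
proof -
  obtain l where "j = k + int m * l"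
    using assms by (metis cong_iff_lin cong_sym)
  thus ?thesis
    using \<omega>_nonzero \<omega> by (simp add: power_int_add power_int_mult)
qed

text \<open>In the quotient the class of a^(q + kt) is \<open>\<omega>\<close>^k times that of a^q.
  So the coefficients on the coset a^q F_x are added with these weights, each coset element being
  met once.\<close>

definition coord :: "int \<Rightarrow> (perm \<Rightarrow> complex) \<Rightarrow> complex" where
  "coord q u = (\<Sum>k\<in>{0..<int m}. \<omega> powi k * u (rot n (q + k * int t)))"

lemma linear_coord: "Vector_Spaces.linear cscale (*) (coord q)"
  by unfold_locales
     (simp_all add: coord_def cscale_def algebra_simps sum.distrib sum_distrib_left)

interpretation coord: Vector_Spaces.linear cscale "(*)" "coord q" for q
  by (rule linear_coord)

lemma coord_ket:
  "coord q (ket (rot n r)) = (if int t dvd r - q then \<omega> powi ((r - q) div int t) else 0)"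
proof (cases "int t dvd r - q")
  case False
  have "rot n (q + k * int t) \<noteq> rot n r" for k
  proof
    assume "rot n (q + k * int t) = rot n r"
    hence "int n dvd r - (q + k * int t)"
      using n_pos by (simp add: rot_eq_iff cong_iff_dvd_diff dvd_diff_commute)
    hence "int t dvd r - (q + k * int t)"
      using t_dvd by (meson dvd_trans of_nat_dvd_iff)
    hence "int t dvd (r - (q + k * int t)) + k * int t"
      by (intro dvd_add) simp_all
    thus False
      using False by simp
  qed
  thus ?thesis
    using False by (simp add: coord_def ket_def)
next
  case True
  then obtain j where j: "r = q + j * int t"
    by (metis dvdE mult.commute diff_eq_eq add.commute)
  have "rot n (q + k * int t) = rot n r \<longleftrightarrow> [k = j] (mod int m)" for k
  proof -
    have "rot n (q + k * int t) = rot n r \<longleftrightarrow> int m * int t dvd (k - j) * int t"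
      using n_pos n_eq by (simp add: rot_eq_iff cong_iff_dvd_diff j algebra_simps flip: of_nat_mult)
    thus ?thesis
      using t_pos by (simp add: cong_iff_dvd_diff)
  qed
  hence "coord q (ket (rot n r)) = (\<Sum>k\<in>{0..<int m}. if k = j mod int m then \<omega> powi k else 0)"
    unfolding coord_def by (intro sum.cong) (auto simp: ket_def cong_def)
  also have "\<dots> = \<omega> powi (j mod int m)"
    using m_pos by simp
  also have "\<dots> = \<omega> powi j"
    by (rule powi_cong) simp
  finally show ?thesis
    using t_pos by (simp add: j)
qed

lemma relation_in_tensor_relations:
  "v *\<^sub>C ket (rot n (r + k * int t)) - (\<omega> powi k * v) *\<^sub>C ket (rot n r) \<in> tensor_relations n x \<rho>"
proof -
  have "v *\<^sub>C ket (rot n r \<circ> rot n (k * int t)) - (\<rho> (rot n (k * int t)) * v) *\<^sub>C ket (rot n r)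
      \<in> tensor_relations n x \<rho>"
    unfolding tensor_relations_def using n_pos stab_eq rot_in_Cyc
    by (intro cfun.span_base) blast
  thus ?thesis
    by (simp add: rot_comp[OF n_pos] \<rho>)
qed

text \<open>The induction principle for the relations in terms of exponents; \<open>V\<close> will
  be the kernel of a coordinate or a preimage under the action.\<close>

lemma tensor_relations_minimal:
  assumes "cfun.subspace V"
    and "\<And>r k v. v *\<^sub>C ket (rot n (r + k * int t)) - (\<omega> powi k * v) *\<^sub>C ket (rot n r) \<in> V"
  shows "tensor_relations n x \<rho> \<subseteq> V"
  unfolding tensor_relations_def
proof (rule cfun.span_minimal[OF _ assms(1)], safe)
  fix c h :: perm and v :: complex
  assume "c \<in> Cyc n" "h \<in> stab n x"
  then obtain r k where "c = rot n r" "h = rot n (k * int t)"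
    using n_pos by (auto simp: Cyc_eq stab_eq)
  thus "v *\<^sub>C ket (c \<circ> h) - (\<rho> h * v) *\<^sub>C ket c \<in> V"
    using assms(2)[of v r k] by (simp add: rot_comp[OF n_pos] \<rho>)
qed

lemma coord_tensor_relations:
  assumes "u \<in> tensor_relations n x \<rho>"
  shows "coord q u = 0"
proof -
  have "tensor_relations n x \<rho> \<subseteq> {u. coord q u = 0}"
  proof (rule tensor_relations_minimal)
    show "cfun.subspace {u. coord q u = 0}"
      by (rule coord.subspace_kernel)
    fix r k :: int and v :: complex
    have "r + k * int t - q = (r - q) + k * int t"
      by simp
    hence "int t dvd r + k * int t - q \<longleftrightarrow> int t dvd r - q"
      "(r + k * int t - q) div int t = k + (r - q) div int t"
      using t_pos by (simp_all only: dvd_add_left_iff dvd_triv_right div_mult_self1)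
    thus "v *\<^sub>C ket (rot n (r + k * int t)) - (\<omega> powi k * v) *\<^sub>C ket (rot n r) \<in> {u. coord q u = 0}"
      using \<omega>_nonzero by (simp add: coord.diff coord.scale coord_ket power_int_add)
  qed
  thus ?thesis
    using assms by blast
qed

lemma sum_residue_class:
  fixes g :: "int \<Rightarrow> 'a :: comm_monoid_add"
  shows "(\<Sum>q\<in>{0..<int t}. if int t dvd r - q then g q else 0) = g (r mod int t)"
proof -
  have "int t dvd r - q \<longleftrightarrow> q = r mod int t" if "q \<in> {0..<int t}" for q
    using that by (auto simp: mod_eq_dvd_iff[symmetric])
  hence "(\<Sum>q\<in>{0..<int t}. if int t dvd r - q then g q else 0)
      = (\<Sum>q\<in>{0..<int t}. if q = r mod int t then g q else 0)"
    by (intro sum.cong) auto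
  thus ?thesis
    using t_pos by simp
qed

text \<open>The residue class of \<open>r\<^sub>0\<close> modulo t has \<open>m\<close> members
  modulo n, and moving r by n changes the quotient by \<open>m\<close>, which the periodic
  \<open>h\<close> does not see.\<close>

lemma sum_periodic_residue_class:
  fixes h :: "int \<Rightarrow> 'a :: comm_monoid_add"
  assumes h: "\<And>j k. [j = k] (mod int m) \<Longrightarrow> h j = h k"
  shows "(\<Sum>r\<in>{0..<int n}. if int t dvd r - r\<^sub>0 then h ((r - r\<^sub>0) div int t) else 0)
    = (\<Sum>j<m. h (int j))"
proof -
  have "(\<Sum>r\<in>{0..<int n}. if int t dvd r - r\<^sub>0 then h ((r - r\<^sub>0) div int t) else 0)
      = (\<Sum>r\<in>{r \<in> {0..<int n}. int t dvd r - r\<^sub>0}. h ((r - r\<^sub>0) div int t))"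
    by (rule sum.inter_filter[symmetric]) simp
  also have "\<dots> = (\<Sum>j<m. h (int j))"
  \<comment> \<open>Since r may lie below \<open>r\<^sub>0\<close>, the difference is reduced modulo
    n before dividing, so that the index lands in 0..<m.\<close>
  proof (rule sum.reindex_bij_witness[where i = "\<lambda>j. (r\<^sub>0 + int t * int j) mod int n"
        and j = "\<lambda>r. nat (((r - r\<^sub>0) mod int n) div int t)"])
    fix r assume r: "r \<in> {r \<in> {0..<int n}. int t dvd r - r\<^sub>0}"
    obtain a where a: "r - r\<^sub>0 = int t * a"
      using r by auto
    define b where "b = a mod int m"
    have b: "(r - r\<^sub>0) mod int n = int t * b"
      unfolding a b_def using n_eq by (metis mult_mod_right of_nat_mult)
    have b_range: "0 \<le> b" "b < int m"
      unfolding b_def using m_pos by (simp_all del: of_nat_div)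
    have div: "((r - r\<^sub>0) mod int n) div int t = b"
      using t_pos by (simp add: b)
    show "(r\<^sub>0 + int t * int (nat (((r - r\<^sub>0) mod int n) div int t))) mod int n = r"
      using r b_range unfolding div by (simp add: b[symmetric] mod_add_right_eq)
    show "nat (((r - r\<^sub>0) mod int n) div int t) \<in> {..<m}"
      using b_range unfolding div by (simp only: lessThan_iff nat_less_iff)
    show "h (int (nat (((r - r\<^sub>0) mod int n) div int t))) = h ((r - r\<^sub>0) div int t)"
      unfolding div unfolding a using t_pos b_range by (intro h) (simp add: b_def)
  next
    fix j assume j: "j \<in> {..<m}"
    have "int t * int j < int t * int m"
      using j t_pos by (simp only: lessThan_iff mult_less_cancel_left_pos of_nat_less_iff of_nat_0_less_iff)
    hence "int t * int j < int n"
      using n_eq by (metis of_nat_mult)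
    hence *: "((r\<^sub>0 + int t * int j) mod int n - r\<^sub>0) mod int n = int t * int j"
      by (simp add: mod_diff_left_eq)
    thus "nat ((((r\<^sub>0 + int t * int j) mod int n - r\<^sub>0) mod int n) div int t) = j"
      using t_pos by simp
    have "int t dvd (r\<^sub>0 + int t * int j) mod int n - r\<^sub>0
        \<longleftrightarrow> int t dvd ((r\<^sub>0 + int t * int j) mod int n - r\<^sub>0) mod int n"
      by (rule dvd_mod_n) (simp add: cong_def)
    thus "(r\<^sub>0 + int t * int j) mod int n \<in> {r \<in> {0..<int n}. int t dvd r - r\<^sub>0}"
      unfolding * using n_pos by simp
  qed
  finally show ?thesis .
qed

text \<open>By linearity a single ket suffices: a^r differs from \<open>\<omega>\<close>^(r div t)
  times a^(r mod t) by one defining relation.\<close>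

lemma coord_expansion:
  assumes u: "u \<in> free_space (Cyc n)"
  shows "u - (\<Sum>q\<in>{0..<int t}. coord q u *\<^sub>C ket (rot n q)) \<in> tensor_relations n x \<rho>"
proof -
  have sub: "cfun.subspace (tensor_relations n x \<rho>)"
    unfolding tensor_relations_def by (rule cfun.subspace_span)
  have eq: "u = (\<Sum>c\<in>Cyc n. u c *\<^sub>C ket c)"
    using free_space_expand[OF finite_J_basis(1)[OF n_pos] u] .
  have "coord q u = (\<Sum>c\<in>Cyc n. u c * coord q (ket c))" for q
    by (subst eq) (simp add: coord.sum coord.scale)
  hence "u - (\<Sum>q\<in>{0..<int t}. coord q u *\<^sub>C ket (rot n q)) = (\<Sum>c\<in>Cyc n. u c *\<^sub>C ket c)
      - (\<Sum>q\<in>{0..<int t}. \<Sum>c\<in>Cyc n. u c *\<^sub>C (coord q (ket c) *\<^sub>C ket (rot n q)))"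
    using eq by (simp add: cfun.scale_sum_left)
  also have "\<dots> = (\<Sum>c\<in>Cyc n. u c *\<^sub>C
      (ket c - (\<Sum>q\<in>{0..<int t}. coord q (ket c) *\<^sub>C ket (rot n q))))"
    unfolding sum.swap[of _ _ "{0..<int t}"]
    by (simp add: cfun.scale_right_diff_distrib cfun.scale_sum_right sum_subtractf)
  also have "\<dots> \<in> tensor_relations n x \<rho>"
  proof (intro cfun.subspace_sum[OF sub] cfun.subspace_scale[OF sub])
    fix c assume "c \<in> Cyc n"
    then obtain r where c: "c = rot n r"
      using n_pos by (auto simp: Cyc_eq)
    have "(\<Sum>q\<in>{0..<int t}. coord q (ket c) *\<^sub>C ket (rot n q))
        = (\<Sum>q\<in>{0..<int t}. if int t dvd r - q
            then \<omega> powi ((r - q) div int t) *\<^sub>C ket (rot n q) else 0)"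
      by (intro sum.cong) (auto simp: c coord_ket)
    also have "\<dots> = \<omega> powi (r div int t) *\<^sub>C ket (rot n (r mod int t))"
      unfolding sum_residue_class using t_pos by (simp add: minus_mod_eq_mult_div)
    finally show "ket c - (\<Sum>q\<in>{0..<int t}. coord q (ket c) *\<^sub>C ket (rot n q))
        \<in> tensor_relations n x \<rho>"
      using relation_in_tensor_relations[of 1 "r mod int t" "r div int t"] by (simp add: c)
  qed
  finally show ?thesis .
qed

text \<open>Act by a^(kt) or its inverse, both of which fix x. Hence the delta condition of the
  module action depends only on a coset of F_x.\<close>

lemma act_add_stab:
  assumes y: "y \<in> Sym1 n"
  shows "right_act n y (rot n (r + k * int t)) = x \<longleftrightarrow> right_act n y (rot n r) = x"
proof -
  have fixed: "right_act n x (rot n (k * int t)) = x" for k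
    by (simp add: act_eq_self_iff)
  show ?thesis
    using fixed[of k] fixed[of "- k"] right_act_add[OF n_pos y, of r "k * int t"]
      right_act_add[OF n_pos y, of "r + k * int t" "- k * int t"] by auto
qed

text \<open>A basis element of the algebra turns a defining relation into another one or into 0: by
  \<open>act_add_stab\<close> it cannot kill just one of the two kets.\<close>

lemma J_act_tensor_relations: "J_act n x f ` tensor_relations n x \<rho> \<subseteq> tensor_relations n x \<rho>"
proof -
  let ?K = "tensor_relations n x \<rho>"
  have sub: "cfun.subspace ?K"
    unfolding tensor_relations_def by (rule cfun.subspace_span)
  interpret T: Vector_Spaces.linear cscale cscale "J_act n x f"
    by (rule linear_J_act)
  have "?K \<subseteq> {u. J_act n x f u \<in> ?K}"
  proof (rule tensor_relations_minimal)
    show "cfun.subspace {u. J_act n x f u \<in> ?K}"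
      using T.subspace_linear_preimage[OF sub] .
    fix r k :: int and v :: complex
    define G where "G p r =
      (if right_act n (fst p) (snd p \<circ> rot n r) = x then ket (snd p \<circ> rot n r) else 0)" for p r
    have ket: "J_act n x f (ket (rot n r)) = (\<Sum>p\<in>J_basis n. f p *\<^sub>C G p r)" for r
      unfolding G_def by (rule J_act_ket[OF n_pos rot_in_Cyc[OF n_pos]])
    have "J_act n x f (v *\<^sub>C ket (rot n (r + k * int t)) - (\<omega> powi k * v) *\<^sub>C ket (rot n r))
      = (\<Sum>p\<in>J_basis n. f p *\<^sub>C (v *\<^sub>C G p (r + k * int t) - (\<omega> powi k * v) *\<^sub>C G p r))"
      by (simp only: T.diff T.scale ket cfun.scale_sum_right cfun.scale_right_diff_distrib
            sum_subtractf cfun.scale_left_commute)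
    also have "\<dots> \<in> ?K"
    proof (intro cfun.subspace_sum[OF sub] cfun.subspace_scale[OF sub])
      fix p assume "p \<in> J_basis n"
      then obtain y l where p: "p = (y, rot n l)" and y: "y \<in> Sym1 n"
        using n_pos by (auto simp: J_basis_def Cyc_eq)
      have "right_act n y (rot n (l + (r + k * int t))) = x \<longleftrightarrow> right_act n y (rot n (l + r)) = x"
        using act_add_stab[OF y, of "l + r" k] by (simp add: add.assoc)
      thus "v *\<^sub>C G p (r + k * int t) - (\<omega> powi k * v) *\<^sub>C G p r \<in> ?K"
        using relation_in_tensor_relations[of v "l + r" k] cfun.subspace_0[OF sub]
        by (auto simp: G_def p rot_comp[OF n_pos] add.assoc)
    qed
    finally show "v *\<^sub>C ket (rot n (r + k * int t)) - (\<omega> powi k * v) *\<^sub>C ket (rot n r)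
        \<in> {u. J_act n x f u \<in> ?K}"
      by simp
  qed
  thus ?thesis
    by blast
qed

lemma induced_char_eq:
  "induced_char n x \<rho> f = (\<Sum>q\<in>{0..<int t}. coord q (J_act n x f (ket (rot n q))))"
  unfolding induced_char_def
proof (rule quot_trace_eq[where \<phi> = coord and b = "\<lambda>q. ket (rot n q)"])
  show "cfun.subspace (tensor_relations n x \<rho>)"
    unfolding tensor_relations_def by (rule cfun.subspace_span)
  show "(\<lambda>q. ket (rot n q)) ` {0..<int t} \<subseteq> free_space (Cyc n)"
    by (auto intro!: ket_in_free_space rot_in_Cyc n_pos)
  show "coord q (ket (rot n r)) = (if q = r then 1 else 0)"
    if "q \<in> {0..<int t}" "r \<in> {0..<int t}" for q r
  proof -
    have "int t dvd r - q \<longleftrightarrow> q = r"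
      using that by (auto simp: mod_eq_dvd_iff[symmetric])
    thus ?thesis
      by (simp add: coord_ket)
  qed
qed (use J_act_in_free_space[OF n_pos] coord_tensor_relations coord_expansion linear_coord
      linear_J_act J_act_tensor_relations in auto)

section \<open>The indicator as a sum over the orbit\<close>

text \<open>The coordinate of a^w a^q at a^q, by \<open>coord_ket\<close> the same for every q; it
  vanishes unless a^w preserves the coset a^q F_x.\<close>

definition weight :: "int \<Rightarrow> complex" where
  "weight w = (if int t dvd w then \<omega> powi (w div int t) else 0)"

text \<open>The summed traces of p_(z^-1) # a^(z(r) + r), in the basis of classes of a^q; the factor
  1/n of the integral is left out.\<close>

definition contribution :: "perm \<Rightarrow> complex" where
  "contribution z = (\<Sum>r\<in>{0..<int n}. if right_act n z (rot n r) = inv\<^bsub>SymZ n\<^esub> z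
     then \<Sum>q\<in>{0..<int t}. if right_act n (inv\<^bsub>SymZ n\<^esub> z) (rot n (z (r mod int n) + r + q)) = x
       then weight (z (r mod int n) + r) else 0
     else 0)"

lemma fs_indicator_eq_sum:
  "fs_indicator n (induced_char n x \<rho>) = (\<Sum>z\<in>Sym1 n. contribution z) / of_nat n"
proof -
  let ?w = "\<lambda>a. left_act n (fst a) (snd a) \<circ> snd a"
  let ?D = "\<lambda>a q. if right_act n (inv\<^bsub>SymZ n\<^esub> (fst a)) (?w a \<circ> rot n q) = x
      then coord q (ket (?w a \<circ> rot n q)) else 0"
  have fin: "finite (J_basis n)"
    using finite_J_basis[OF n_pos] by (simp add: J_basis_def)
  have sub: "(\<lambda>a. (inv\<^bsub>SymZ n\<^esub> (fst a), ?w a)) ` fs_index n \<subseteq> J_basis n"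
    using n_pos by (auto simp: fs_index_def J_basis_def inv_Sym1 Cyc_eq left_act_rot rot_comp)
  have "coord q (J_act n x (mult_tensor n (J_comult n (J_integral n))) (ket (rot n q)))
      = (\<Sum>a\<in>fs_index n. ?D a q / of_nat n)" for q
  proof -
    have "J_act n x (mult_tensor n (J_comult n (J_integral n))) (ket (rot n q))
        = (\<Sum>a\<in>fs_index n. (1 / of_nat n) *\<^sub>C
            (if right_act n (inv\<^bsub>SymZ n\<^esub> (fst a)) (?w a \<circ> rot n q) = x
             then ket (?w a \<circ> rot n q) else 0))"
      unfolding J_act_ket[OF n_pos rot_in_Cyc[OF n_pos]] mult_tensor_integral[OF n_pos]
        case_prod_unfold sum_ket_combination[OF fin sub] by (simp cong: if_cong)
    thus ?thesis
      by (auto simp: coord.sum coord.scale coord.zero intro!: sum.cong)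
  qed
  hence "fs_indicator n (induced_char n x \<rho>)
      = (\<Sum>a\<in>fs_index n. \<Sum>q\<in>{0..<int t}. ?D a q) / of_nat n"
    unfolding fs_indicator_def induced_char_eq
    by (simp add: sum.swap[of _ "{0..<int t}"] sum_divide_distrib)
  also have "(\<Sum>a\<in>fs_index n. \<Sum>q\<in>{0..<int t}. ?D a q)
      = (\<Sum>a\<in>J_basis n. if right_act n (fst a) (snd a) = inv\<^bsub>SymZ n\<^esub> (fst a)
          then \<Sum>q\<in>{0..<int t}. ?D a q else 0)"
    by (simp add: fs_index_def case_prod_unfold sum.inter_filter[OF fin])
  also have "\<dots> = (\<Sum>z\<in>Sym1 n. \<Sum>b\<in>Cyc n. if right_act n z b = inv\<^bsub>SymZ n\<^esub> z
          then \<Sum>q\<in>{0..<int t}. ?D (z, b) q else 0)"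
    unfolding J_basis_def by (simp add: sum.cartesian_product case_prod_unfold cong: if_cong)
  also have "\<dots> = (\<Sum>z\<in>Sym1 n. contribution z)"
  proof (rule sum.cong[OF refl])
    fix z assume z: "z \<in> Sym1 n"
    have D: "?D (z, rot n r) q = (if right_act n (inv\<^bsub>SymZ n\<^esub> z) (rot n (z (r mod int n) + r + q)) = x
       then weight (z (r mod int n) + r) else 0)" for r q
      by (simp add: left_act_rot[OF n_pos z] rot_comp[OF n_pos] coord_ket weight_def)
    show "(\<Sum>b\<in>Cyc n. if right_act n z b = inv\<^bsub>SymZ n\<^esub> z
          then \<Sum>q\<in>{0..<int t}. ?D (z, b) q else 0) = contribution z"
      unfolding contribution_def sum.reindex_bij_betw[OF bij_betw_rot_Cyc[OF n_pos], symmetric] D ..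
  qed
  finally show ?thesis .
qed

text \<open>A nonzero term supplies z <| a^r = z^-1 together with an exponent carrying z^-1 to x, so
  z itself is carried to x.\<close>

lemma contribution_nonzero_in_orbit:
  assumes z: "z \<in> Sym1 n" and nz: "contribution z \<noteq> 0"
  shows "z \<in> orb ` {0..<int t}"
proof -
  let ?I = "\<lambda>r q. if right_act n (inv\<^bsub>SymZ n\<^esub> z) (rot n (z (r mod int n) + r + q)) = x
       then weight (z (r mod int n) + r) else 0"
  obtain r where "(if right_act n z (rot n r) = inv\<^bsub>SymZ n\<^esub> z
      then \<Sum>q\<in>{0..<int t}. ?I r q else 0) \<noteq> 0"
    using sum.not_neutral_contains_not_neutral[OF nz[unfolded contribution_def]] .
  hence r: "right_act n z (rot n r) = inv\<^bsub>SymZ n\<^esub> z" and "(\<Sum>q\<in>{0..<int t}. ?I r q) \<noteq> 0"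
    by (simp_all split: if_splits)
  then obtain q where "?I r q \<noteq> 0"
    using sum.not_neutral_contains_not_neutral by blast
  \<comment> \<open>Here \<open>q\<close> is rebound to the whole exponent z(r) + r + q.\<close>
  then obtain q where "right_act n (inv\<^bsub>SymZ n\<^esub> z) (rot n q) = x"
    by (auto split: if_splits)
  hence "right_act n z (rot n (r + q)) = x"
    using right_act_add[OF n_pos z, of r q] by (simp add: r)
  hence "z = orb (- (r + q))"
    using right_act_add[OF n_pos z, of "r + q" "- (r + q)"] right_act_0[OF n_pos z] by simp
  also have "\<dots> = orb ((- (r + q)) mod int t)"
    by (simp add: orb_eq_iff minus_mod_eq_mult_div)
  finally show ?thesis
    using t_pos by auto
qed

lemma sum_contribution:
  "(\<Sum>z\<in>Sym1 n. contribution z) = (\<Sum>p\<in>{0..<int t}. contribution (orb p))"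
proof -
  have "inj_on orb {0..<int t}"
    by (auto simp: inj_on_def orb_eq_iff mod_eq_dvd_iff[symmetric])
  hence "(\<Sum>p\<in>{0..<int t}. contribution (orb p)) = (\<Sum>z\<in>orb ` {0..<int t}. contribution z)"
    by (simp add: sum.reindex)
  also have "\<dots> = (\<Sum>z\<in>Sym1 n. contribution z)"
    using orb_in_Sym1 contribution_nonzero_in_orbit finite_J_basis[OF n_pos]
    by (intro sum.mono_neutral_left) auto
  finally show ?thesis ..
qed

section \<open>Evaluation in terms of u1 and u2\<close>

context
  fixes u\<^sub>1 u\<^sub>2 :: int
  assumes u1: "[X (int t) + int t = u\<^sub>1 * int t] (mod int n)"
    and u2: "[X s + s = u\<^sub>2 * int t] (mod int n)"
begin

text \<open>Since \<open>x\<^sup>-\<^sup>1 = x \<lhd> a\<^sup>s\<close>, the point \<open>x(s) + s\<close> is fixed by \<open>x\<close>; now evaluate \<open>x\<close> at \<open>u\<^sub>2 t\<close>.\<close>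

lemma two_u2_cong: "[2 * u\<^sub>2 = u\<^sub>1 * u\<^sub>2] (mod int m)"
proof -
  have "X (u\<^sub>2 * int t) = X (s + X s)"
    using u2 by (simp add: cong_def add.commute)
  hence 1: "[X (u\<^sub>2 * int t) = u\<^sub>2 * int t] (mod int n)"
    using cong_trans[OF X_s_X[of s] u2] by simp
  \<comment> \<open>By additivity x(u2 t) = u2 x(t) = u2 (u1 - 1) t, which is compared with the
    fixed point u2 t; cancelling t turns the modulus n into \<open>m\<close>.\<close>
  have "[u\<^sub>2 * (X (int t) + int t) = u\<^sub>2 * (u\<^sub>1 * int t)] (mod int n)"
    using u1 by (rule cong_scalar_left)
  moreover have "[X (u\<^sub>2 * int t) + u\<^sub>2 * int t = u\<^sub>2 * X (int t) + u\<^sub>2 * int t] (mod int n)"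
    using X_mult_t cong_add cong_refl by blast
  moreover have "[X (u\<^sub>2 * int t) + u\<^sub>2 * int t = u\<^sub>2 * int t + u\<^sub>2 * int t] (mod int n)"
    using 1 cong_add cong_refl by blast
  ultimately have "[u\<^sub>2 * int t + u\<^sub>2 * int t = u\<^sub>2 * (u\<^sub>1 * int t)] (mod int n)"
    by (simp add: algebra_simps cong_def)
  hence "[(2 * u\<^sub>2) * int t = (u\<^sub>1 * u\<^sub>2) * int t] (mod int m * int t)"
    using n_eq by (simp add: algebra_simps flip: of_nat_mult)
  thus ?thesis
    using t_pos by (simp add: cong_iff_dvd_diff flip: left_diff_distrib)
qed

text \<open>At r = s + x(p) - p + d the value is x(s + x(p) + d) - x(p). By \<open>X_s_X\<close> the
  first term is x(s) + p + x(d), so adding r cancels both p and x(p).\<close>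

lemma orb_value_add:
  assumes "int t dvd d"
  shows "[orb p ((s + X p - p + d) mod int n) + (s + X p - p + d)
    = (u\<^sub>2 + d div int t * u\<^sub>1) * int t] (mod int n)"
proof -
  define j where "j = d div int t"
  have d: "d = j * int t"
    using assms by (simp add: j_def)
  have "[orb p ((s + X p - p + d) mod int n) = X (s + X p + d) - X p] (mod int n)"
    using orb_value[of p "s + X p - p + d"] by (simp add: algebra_simps)
  also have "[X (s + X p + d) - X p = (X s + p + j * X (int t)) - X p] (mod int n)"
    using cong_trans[OF X_add[OF assms] cong_add[OF X_s_X X_mult_t[of j, folded d]]]
    by (rule cong_diff) (rule cong_refl)
  finally have "[orb p ((s + X p - p + d) mod int n) + (s + X p - p + d)
      = (X s + p + j * X (int t)) - X p + (s + X p - p + d)] (mod int n)"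
    by (rule cong_add) (rule cong_refl)
  also have "(X s + p + j * X (int t)) - X p + (s + X p - p + d) = (X s + s) + j * (X (int t) + int t)"
    by (simp add: d algebra_simps)
  also have "[(X s + s) + j * (X (int t) + int t) = u\<^sub>2 * int t + j * (u\<^sub>1 * int t)] (mod int n)"
    using u1 u2 by (intro cong_add cong_scalar_left)
  finally show ?thesis
    by (simp add: j_def algebra_simps)
qed

lemma weight_mult_t:
  assumes "[w = v * int t] (mod int n)"
  shows "weight w = \<omega> powi v"
proof -
  have "int t dvd w"
    using dvd_mod_n[OF assms] by simp
  then obtain v' where w: "w = v' * int t"
    by (metis dvdE mult.commute)
  hence "int m * int t dvd (v' - v) * int t"
    using assms n_eq by (simp add: cong_iff_dvd_diff algebra_simps flip: of_nat_mult)
  hence "[v' = v] (mod int m)"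
    using t_pos by (simp add: cong_iff_dvd_diff)
  thus ?thesis
    using t_pos powi_cong by (simp add: w weight_def)
qed

lemma contribution_orb: "contribution (orb p) = (\<Sum>j<m. \<omega> powi (u\<^sub>2 + int j * u\<^sub>1))"
proof -
  \<comment> \<open>This solves p + r = s + x(p), which matches the exponents of z <| a^r and
    z^-1.\<close>
  let ?r0 = "s + X p - p" and ?z = "orb p"
  have inv_iff: "right_act n ?z (rot n r) = inv\<^bsub>SymZ n\<^esub> ?z \<longleftrightarrow> int t dvd r - ?r0" for r
    unfolding inv_orb orb_act orb_eq_iff by (simp add: algebra_simps)
  have inner: "(\<Sum>q\<in>{0..<int t}. if right_act n (inv\<^bsub>SymZ n\<^esub> ?z) (rot n (?z (r mod int n) + r + q)) = x
       then weight (?z (r mod int n) + r) else 0) = \<omega> powi (u\<^sub>2 + (r - ?r0) div int t * u\<^sub>1)"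
    if r: "int t dvd r - ?r0" for r
  proof -
    let ?w = "?z (r mod int n) + r"
    have w: "[?w = (u\<^sub>2 + (r - ?r0) div int t * u\<^sub>1) * int t] (mod int n)"
      using orb_value_add[OF r, of p] by simp
    \<comment> \<open>Exactly one q in 0..<t meets the condition, so the trace consists of a single
      weight. The sign is flipped to match the shape of \<open>sum_residue_class\<close>.\<close>
    have "right_act n (inv\<^bsub>SymZ n\<^esub> ?z) (rot n (?w + q)) = x \<longleftrightarrow> int t dvd - (s + X p + ?w) - q" for q
      unfolding inv_orb orb_act act_eq_self_iff
      by (subst dvd_minus_iff[symmetric]) (simp add: algebra_simps)
    thus ?thesis
      using sum_residue_class[of "- (s + X p + ?w)" "\<lambda>_. weight ?w"] weight_mult_t[OF w] by simp
  qed
  have "contribution ?z = (\<Sum>r\<in>{0..<int n}. if int t dvd r - ?r0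
      then \<omega> powi (u\<^sub>2 + (r - ?r0) div int t * u\<^sub>1) else 0)"
    unfolding contribution_def inv_iff by (intro sum.cong refl if_cong inner)
  also have "\<dots> = (\<Sum>j<m. \<omega> powi (u\<^sub>2 + int j * u\<^sub>1))"
    by (rule sum_periodic_residue_class[where h = "\<lambda>j. \<omega> powi (u\<^sub>2 + j * u\<^sub>1)"])
       (intro powi_cong cong_add cong_scalar_right cong_refl)
  finally show ?thesis .
qed

text \<open>All t orbit elements contribute the same geometric sum. Its ratio is an m-th root of
  unity, so it vanishes or has m equal terms, and then t m = n cancels the normalization.\<close>

lemma fs_indicator_eq:
  "fs_indicator n (induced_char n x \<rho>) = (if \<omega> powi u\<^sub>1 = 1 then \<omega> powi u\<^sub>2 else 0)"
proof -
  have "(\<Sum>j<m. \<omega> powi (u\<^sub>2 + int j * u\<^sub>1)) = (\<Sum>j<m. \<omega> powi u\<^sub>2 * (\<omega> powi u\<^sub>1) ^ j)"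
    using \<omega>_nonzero by (simp add: power_int_add power_int_mult mult.commute[of "int _" u\<^sub>1])
  also have "\<dots> = \<omega> powi u\<^sub>2 * (if \<omega> powi u\<^sub>1 = 1 then of_nat m else 0)"
  proof -
    have "(\<omega> powi u\<^sub>1) ^ m = (\<omega> powi int m) powi u\<^sub>1"
      unfolding power_int_mult[symmetric] by (simp add: mult.commute power_int_mult)
    hence "(\<omega> powi u\<^sub>1) ^ m = 1"
      using \<omega> by simp
    thus ?thesis
      by (simp add: sum_root_of_unity_powers flip: sum_distrib_left)
  qed
  finally have "fs_indicator n (induced_char n x \<rho>)
      = of_nat t * (\<omega> powi u\<^sub>2 * (if \<omega> powi u\<^sub>1 = 1 then of_nat m else 0)) / of_nat n"
    by (simp add: fs_indicator_eq_sum sum_contribution contribution_orb)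
  moreover have "(of_nat n :: complex) = of_nat t * of_nat m"
    using n_eq by (metis of_nat_mult)
  ultimately show ?thesis
    using t_pos m_pos by simp
qed

text \<open>By \<open>two_u2_cong\<close> the square is a power of
  \<open>\<omega> powi u\<^sub>1\<close>, hence 1. For odd \<open>m\<close> the value -1 is
  excluded, as it is not an m-th root of unity.\<close>

lemma powi_u2:
  assumes "\<omega> powi u\<^sub>1 = 1"
  shows "\<omega> powi u\<^sub>2 \<in> {1, - 1}" and "odd m \<Longrightarrow> \<omega> powi u\<^sub>2 = 1"
proof -
  have "(\<omega> powi u\<^sub>2)\<^sup>2 = \<omega> powi (2 * u\<^sub>2)"
    by (simp add: power_int_mult mult.commute[of 2])
  also have "\<dots> = \<omega> powi (u\<^sub>1 * u\<^sub>2)"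
    using two_u2_cong by (rule powi_cong)
  also have "\<dots> = 1"
    using assms by (simp add: power_int_mult)
  finally show pm: "\<omega> powi u\<^sub>2 \<in> {1, - 1}"
    by (simp add: power2_eq_1_iff)
  have "(\<omega> powi u\<^sub>2) ^ m = (\<omega> powi int m) powi u\<^sub>2"
    unfolding power_int_mult[symmetric] by (simp add: mult.commute power_int_mult)
  hence "(\<omega> powi u\<^sub>2) ^ m = 1"
    using \<omega> by simp
  thus "\<omega> powi u\<^sub>2 = 1" if "odd m"
    using pm that by auto
qed

end

end

end

section \<open>The stabilizer and its representations\<close>

lemma generate_rot:
  assumes "n > 0"
  shows "generate (SymZ n) {rot n r} = range (\<lambda>k. rot n (k * r))"
proof -
  have "shift n = rot n 1"
    by (simp add: shift_def rot_def)
  hence "shift n \<in> carrier (SymZ n)"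
    using rot_carrier[OF assms] by simp
  hence "rot n r [^]\<^bsub>SymZ n\<^esub> k = rot n (k * r)" for k :: int
    using group.int_pow_pow[OF group_SymZ]
    by (simp add: mult.commute flip: shift_int_pow[OF assms])
  thus ?thesis
    using group.generate_pow[OF group_SymZ rot_carrier[OF assms]] by (auto simp: image_def)
qed

text \<open>By Bezout gcd(r, n) is a multiple of r modulo n. This is how the minimality of t forces
  t to divide n.\<close>

lemma generate_rot_gcd:
  assumes "n > 0"
  shows "generate (SymZ n) {rot n (gcd r (int n))} = generate (SymZ n) {rot n r}"
proof -
  obtain a b where ab: "a * r + b * int n = gcd r (int n)"
    using bezout_int by blast
  have "rot n (k * gcd r (int n)) = rot n ((k * a) * r)" for k
    using assms by (simp add: rot_eq_iff cong_iff_dvd_diff flip: ab) (simp add: algebra_simps)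
  moreover obtain c where "r = c * gcd r (int n)"
    by (metis dvdE gcd_dvd1 mult.commute)
  hence "rot n (k * r) = rot n ((k * c) * gcd r (int n))" for k
    by (metis mult.assoc)
  ultimately show ?thesis
    unfolding generate_rot[OF assms] by blast
qed

text \<open>The value at the identity is idempotent and nonzero, hence 1; positive exponents follow
  by induction, negative ones by uniqueness of inverses.\<close>

lemma hom_rot_powi:
  assumes n: "n > 0" and S: "range (\<lambda>k. rot n (k * r)) \<subseteq> S"
    and \<rho>: "\<rho> \<in> hom (SymZ n\<lparr>carrier := S\<rparr>) nonzero_complex"
  shows "\<rho> (rot n (k * r)) = \<rho> (rot n r) powi k"
proof -
  have mem: "rot n (k * r) \<in> S" for k
    using S by blast
  have mult: "\<rho> (rot n ((j + k) * r)) = \<rho> (rot n (j * r)) * \<rho> (rot n (k * r))" for j k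
  proof -
    have "\<rho> (rot n (j * r) \<circ> rot n (k * r)) = \<rho> (rot n (j * r)) * \<rho> (rot n (k * r))"
      using mem \<rho> by (simp add: hom_def SymZ_def nonzero_complex_def)
    thus ?thesis
      by (simp add: rot_comp[OF n] distrib_right)
  qed
  have nonzero: "\<rho> (rot n (k * r)) \<noteq> 0" for k
    using mem \<rho> by (auto simp: hom_def nonzero_complex_def)
  have zero: "\<rho> (rot n (0 * r)) = 1"
    using mult[of 0 0] nonzero[of 0] by simp
  have nat: "\<rho> (rot n (int k * r)) = \<rho> (rot n r) ^ k" for k
  proof (induction k)
    case (Suc k)
    thus ?case
      using mult[of 1 "int k"] by simp
  qed (use zero in simp)
  show ?thesis
  proof (cases "k \<ge> 0")
    case True
    thus ?thesis
      using nat[of "nat k"] by (simp add: power_int_def)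
  next
    case False
    hence "inverse (\<rho> (rot n r) ^ nat (- k)) = \<rho> (rot n (k * r))"
      using mult[of "- k" k] zero nat[of "nat (- k)"] by (intro inverse_unique) simp
    thus ?thesis
      using False by (simp add: power_int_def power_inverse)
  qed
qed

theorem theorem4p3p2:
  fixes n t :: nat and x :: perm and s i :: int and \<zeta> :: complex and \<rho> :: "perm \<Rightarrow> complex"
  assumes "n \<ge> 2"
    and "x \<in> Sym1 n"
    and "t > 0" and "stab n x = generate (SymZ n) {shift n [^]\<^bsub>SymZ n\<^esub> t}"
    and "\<And>t'. t' > 0 \<Longrightarrow> stab n x = generate (SymZ n) {shift n [^]\<^bsub>SymZ n\<^esub> (t'::nat)} \<Longrightarrow> t \<le> t'"
    and "inv\<^bsub>SymZ n\<^esub> x = right_act n x (shift n [^]\<^bsub>SymZ n\<^esub> s)"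
    and "primitive_root_of_unity (n div t) \<zeta>"
    and "\<rho> \<in> hom (SymZ n\<lparr>carrier := stab n x\<rparr>) nonzero_complex"
    and "\<rho> (shift n [^]\<^bsub>SymZ n\<^esub> t) = \<zeta> powi i"
  shows
    "(\<exists>u\<^sub>1::int. [x (int t mod int n) + int t = u\<^sub>1 * int t] (mod int n)) \<and>
     (\<exists>u\<^sub>2::int. [x (s mod int n) + s = u\<^sub>2 * int t] (mod int n)) \<and>
     (\<forall>u\<^sub>1 u\<^sub>2.
        [x (int t mod int n) + int t = u\<^sub>1 * int t] (mod int n) \<and>
        [x (s mod int n) + s = u\<^sub>2 * int t] (mod int n) \<longrightarrow>
        (odd (n div t) \<longrightarrow>
           (\<zeta> powi (i * u\<^sub>1) = 1 \<longrightarrow> fs_indicator n (induced_char n x \<rho>) = 1) \<and>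
           (\<zeta> powi (i * u\<^sub>1) \<noteq> 1 \<longrightarrow> fs_indicator n (induced_char n x \<rho>) = 0)) \<and>
        (even (n div t) \<longrightarrow>
           (\<zeta> powi (i * u\<^sub>1) = 1 \<longrightarrow>
              fs_indicator n (induced_char n x \<rho>) = \<zeta> powi (- (i * u\<^sub>2)) \<and>
              \<zeta> powi (- (i * u\<^sub>2)) \<in> {1, - 1}) \<and>
           (\<zeta> powi (i * u\<^sub>1) \<noteq> 1 \<longrightarrow> fs_indicator n (induced_char n x \<rho>) = 0)))"
proof -
  have n: "n > 0"
    using assms(1) by simp
  have stab_eq: "stab n x = range (\<lambda>k. rot n (k * int t))"
    using assms(4) by (simp add: shift_nat_pow[OF n] generate_rot[OF n])
  have "stab n x = generate (SymZ n) {shift n [^]\<^bsub>SymZ n\<^esub> gcd t n}"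
    using assms(4) generate_rot_gcd[OF n, of "int t"] by (simp add: shift_nat_pow[OF n])
  \<comment> \<open>The exponent gcd(t, n) generates the same stabilizer, so it competes with the
    minimal t.\<close>
  hence "t \<le> gcd t n"
    using n by (intro assms(5)) simp_all
  hence t_dvd: "t dvd n"
    using n by (metis dvd_imp_le gcd_dvd1 gcd_dvd2 le_antisym assms(3))
  have act_eq_self_iff: "right_act n x (rot n r) = x \<longleftrightarrow> int t dvd r" for r
  proof -
    have "right_act n x (rot n r) = x \<longleftrightarrow> rot n r \<in> stab n x"
      using rot_in_Cyc[OF n] by (simp add: stab_def)
    also have "\<dots> \<longleftrightarrow> (\<exists>k. [r = k * int t] (mod int n))"
      by (auto simp: stab_eq rot_eq_iff[OF n] image_iff)
    also have "\<dots> \<longleftrightarrow> int t dvd r"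
    proof
      assume "\<exists>k. [r = k * int t] (mod int n)"
      then obtain k where "[r = k * int t] (mod int t)"
        using t_dvd cong_dvd_modulus by (metis of_nat_dvd_iff)
      thus "int t dvd r"
        by (simp add: cong_def dvd_eq_mod_eq_0)
    qed (metis cong_refl dvdE mult.commute)
    finally show ?thesis .
  qed
  interpret inverse_orbit n t x s
    using n assms(2,3,6) t_dvd act_eq_self_iff by unfold_locales (simp_all add: shift_int_pow)
  define \<omega> where "\<omega> = \<zeta> powi i"
  have \<omega>_powi: "\<omega> powi u = \<zeta> powi (i * u)" for u
    by (simp add: \<omega>_def power_int_mult)
  have "\<omega> ^ m = (\<zeta> powi int m) powi i"
    using \<omega>_powi[of "int m"] unfolding power_int_mult[symmetric] by (simp add: mult.commute)
  hence \<omega>: "\<omega> ^ m = 1"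
    using assms(7) by (simp add: primitive_root_of_unity_def)
  have \<rho>: "\<rho> (rot n (k * int t)) = \<omega> powi k" for k
    using hom_rot_powi[OF n _ assms(8), of "int t" k] assms(9)
    by (simp add: stab_eq \<omega>_def shift_nat_pow[OF n])
  have main: "fs_indicator n (induced_char n x \<rho>) =
        (if \<zeta> powi (i * u\<^sub>1) = 1 then \<zeta> powi (- (i * u\<^sub>2)) else 0) \<and>
      (\<zeta> powi (i * u\<^sub>1) = 1 \<longrightarrow> \<zeta> powi (- (i * u\<^sub>2)) \<in> {1, - 1} \<and>
        (odd m \<longrightarrow> \<zeta> powi (- (i * u\<^sub>2)) = 1))"
    if u: "[X (int t) + int t = u\<^sub>1 * int t] (mod int n)" "[X s + s = u\<^sub>2 * int t] (mod int n)"
    for u\<^sub>1 u\<^sub>2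
  proof -
    \<comment> \<open>The computed value is \<open>\<omega> powi u\<^sub>2\<close> and the stated
      one its inverse; a sign equals its own inverse.\<close>
    have "\<zeta> powi (- (i * u\<^sub>2)) = inverse (\<omega> powi u\<^sub>2)"
      by (simp add: power_int_minus \<omega>_powi)
    thus ?thesis
      unfolding \<omega>_powi[symmetric]
      using fs_indicator_eq[OF stab_eq \<rho> \<omega> u] powi_u2[OF stab_eq \<rho> \<omega> u] by auto
  qed
  show ?thesis
    by (intro conjI exists_multiples allI impI; elim conjE; drule (1) main; simp)
qed

end
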